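(* Let $S=k[X_1,\dots,X_d]$ be a polynomial ring over a field $k$, let $r\ge1$, and let $I_1,\dots,I_r$ be arbitrary nonzero monomial ideals in $S$. Suppose that $\boldsymbol I^{\boldsymbol n}=I_1^{n_1}\cdots I_r^{n_r}$ is integrally closed for any $\boldsymbol n=(n_1,\dots,n_r)\in\mathbb{N}^r$ with $0\le|\boldsymbol n|\le\lambda(I_1\cdots I_r)-1$. Then all the power products $\boldsymbol I^{\boldsymbol n}$, $\boldsymbol n\in\mathbb{N}^r$, of $I_1,\dots,I_r$ are integrally closed.
   Context: $\mathbb{N}$ contains $0$; $|\boldsymbol n|=n_1+\cdots+n_r$. A monomial ideal is an ideal generated by monomials in $X_1,\dots,X_d$. An ideal is integrally closed if it equals its integral closure in $S$. For a monomial ideal $I$ of $S$, $\lambda(I)$ denotes its analytic spread (at the homogeneous maximal ideal $\mathfrak m=(X_1,\dots,X_d)$), i.e. the Krull dimension of $\bigoplus_{n\ge0}I^n/\mathfrak mI^n$. *)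

theory Defs
  imports
    "HOL-Algebra.Algebra"
    "HOL-Algebra.Algebraic_Closure_Type"
    "HOL-Library.Poly_Mapping"
    "HOL-Library.Extended_Nat"
begin

section \<open>Ideals in a commutative ring\<close>

text \<open>Powers and products of ideals are taken in the multiplicative monoid
  \<^const>\<open>ideals_set\<close> of ideals, whose unit is the whole ring; in particular \<open>I\<^sup>0\<close> is the
  whole ring.\<close>

abbreviation ideal_pow :: "('a, 'b) ring_scheme \<Rightarrow> 'a set \<Rightarrow> nat \<Rightarrow> 'a set" where
  "ideal_pow R I n \<equiv> I [^]\<^bsub>ideals_set R\<^esub> n"

definition power_product ::
  "('a, 'b) ring_scheme \<Rightarrow> nat \<Rightarrow> (nat \<Rightarrow> 'a set) \<Rightarrow> (nat \<Rightarrow> nat) \<Rightarrow> 'a set" where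
  "power_product R r I n = (\<Otimes>\<^bsub>ideals_set R\<^esub> j\<in>{1..r}. ideal_pow R (I j) (n j))"

text \<open>An equation of integral dependence of \<open>x\<close> on \<open>I\<close> is
  \<open>x\<^sup>m + a\<^sub>1 x\<^sup>m\<^sup>-\<^sup>1 + \<dots> + a\<^sub>m = 0\<close> with \<open>m \<ge> 1\<close> and \<open>a\<^sub>i \<in> I\<^sup>i\<close>.\<close>

definition ideal_integral_closure :: "('a, 'b) ring_scheme \<Rightarrow> 'a set \<Rightarrow> 'a set" where
  "ideal_integral_closure R I = {x \<in> carrier R. \<exists>m\<ge>1. \<exists>a :: nat \<Rightarrow> 'a.
     (\<forall>i\<in>{1..m}. a i \<in> ideal_pow R I i) \<and>
     x [^]\<^bsub>R\<^esub> m \<oplus>\<^bsub>R\<^esub> (\<Oplus>\<^bsub>R\<^esub> i\<in>{1..m}. a i \<otimes>\<^bsub>R\<^esub> x [^]\<^bsub>R\<^esub> (m - i)) = \<zero>\<^bsub>R\<^esub>}"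

definition integrally_closed_ideal :: "('a, 'b) ring_scheme \<Rightarrow> 'a set \<Rightarrow> bool" where
  "integrally_closed_ideal R I \<longleftrightarrow> ideal I R \<and> ideal_integral_closure R I = I"

text \<open>Supremum of the lengths \<open>l\<close> of chains \<open>P\<^sub>0 \<subset> \<dots> \<subset> P\<^sub>l\<close> of prime ideals; the value is
  0 (rather than \<open>-\<infinity>\<close>) for the zero ring.\<close>

definition krull_dim :: "('a, 'b) ring_scheme \<Rightarrow> enat" where
  "krull_dim R = Sup {enat l | l. \<exists>P :: nat \<Rightarrow> 'a set.
     (\<forall>i\<le>l. primeideal (P i) R) \<and> (\<forall>i<l. P i \<subset> P (Suc i))}"

section \<open>The fiber cone\<close>

text \<open>The graded ring \<open>\<Oplus>\<^sub>n I\<^sup>n / M I\<^sup>n\<close>. An element is a sequence \<open>F\<close> whose entry \<open>F n\<close> is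
  a coset of \<open>M I\<^sup>n\<close> contained in \<open>I\<^sup>n\<close> and is the zero coset for all but finitely many \<open>n\<close>.
  The product of the classes of \<open>a \<in> I\<^sup>i\<close> and \<open>b \<in> I\<^sup>j\<close> is the class of \<open>a b\<close> in
  \<open>I\<^sup>i\<^sup>+\<^sup>j / M I\<^sup>i\<^sup>+\<^sup>j\<close>, and the components of a general product are added up in
  \<open>I\<^sup>n / M I\<^sup>n \<subseteq> R / M I\<^sup>n\<close>.\<close>

definition fiber_cone ::
  "('a, 'b) ring_scheme \<Rightarrow> 'a set \<Rightarrow> 'a set \<Rightarrow> (nat \<Rightarrow> 'a set) ring" where
  "fiber_cone R M I =
    (let Q = (\<lambda>n. ideal_prod R M (ideal_pow R I n)) in
     \<lparr>carrier = {F. (\<forall>n. \<exists>a \<in> ideal_pow R I n. F n = Q n +>\<^bsub>R\<^esub> a) \<and> finite {n. F n \<noteq> Q n}},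
      monoid.mult = (\<lambda>F G n. \<Oplus>\<^bsub>R Quot Q n\<^esub> i\<in>{..n}. rcoset_mult R (Q n) (F i) (G (n - i))),
      one = (\<lambda>n. if n = 0 then Q 0 +>\<^bsub>R\<^esub> \<one>\<^bsub>R\<^esub> else Q n),
      ring.zero = Q,
      add = (\<lambda>F G n. F n \<oplus>\<^bsub>R Quot Q n\<^esub> G n)\<rparr>)"

section \<open>Polynomial rings and monomial ideals\<close>

text \<open>Polynomials over \<open>'k\<close> in variables indexed by \<open>'x\<close>: finitely supported functions from
  exponent vectors to coefficients, with the convolution product. Finite \<open>'x\<close> with
  \<open>d\<close> elements gives \<open>k[X\<^sub>1, \<dots>, X\<^sub>d]\<close>.\<close>

type_synonym ('x, 'k) mpoly = "('x \<Rightarrow>\<^sub>0 nat) \<Rightarrow>\<^sub>0 'k"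

abbreviation mpoly_ring :: "('x, 'k::comm_ring_1) mpoly ring" where
  "mpoly_ring \<equiv> ring_of_type_algebra"

definition monomial :: "('x \<Rightarrow>\<^sub>0 nat) \<Rightarrow> ('x, 'k::comm_ring_1) mpoly" where
  "monomial u = Poly_Mapping.single u 1"

definition monomial_ideal :: "('x, 'k::comm_ring_1) mpoly set \<Rightarrow> bool" where
  "monomial_ideal I \<longleftrightarrow> (\<exists>U. I = genideal mpoly_ring (monomial ` U))"

definition hom_max_ideal :: "('x, 'k::comm_ring_1) mpoly set" where
  "hom_max_ideal = genideal mpoly_ring (range (\<lambda>i. monomial (Poly_Mapping.single i 1)))"

definition analytic_spread :: "('x, 'k::comm_ring_1) mpoly set \<Rightarrow> enat" where
  "analytic_spread I = krull_dim (fiber_cone mpoly_ring hom_max_ideal I)"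

section \<open>The fiber cone is a commutative ring\<close>

context cring
begin

lemma ideal_ideal_pow:
  assumes "ideal I R" shows "ideal (ideal_pow R I n) R"
proof -
  interpret IS: comm_monoid "ideals_set R" by (rule ideals_set_is_comm_monoid)
  have "I \<in> carrier (ideals_set R)" using assms by (simp add: ideals_set_def)
  then have "ideal_pow R I n \<in> carrier (ideals_set R)" by (rule IS.nat_pow_closed)
  then show ?thesis by (simp add: ideals_set_def)
qed

lemma ideal_pow_add:
  assumes "ideal I R"
  shows "ideal_prod R (ideal_pow R I i) (ideal_pow R I j) = ideal_pow R I (i + j)"
proof -
  interpret IS: comm_monoid "ideals_set R" by (rule ideals_set_is_comm_monoid)
  have "I \<in> carrier (ideals_set R)" using assms by (simp add: ideals_set_def)
  from IS.nat_pow_mult[OF this, of i j] show ?thesis by (simp add: ideals_set_def)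
qed

lemma ideal_pow_0: "ideal_pow R I 0 = carrier R"
  by (simp add: ideals_set_def)

lemma finsum_in_ideal:
  assumes "ideal J R" "finite A" "\<And>i. i \<in> A \<Longrightarrow> f i \<in> J"
  shows "(\<Oplus>i\<in>A. f i) \<in> J"
proof -
  interpret J: ideal J R by fact
  show ?thesis using assms(2,3)
  proof (induction A rule: finite_induct)
    case empty then show ?case by simp
  next
    case (insert x A)
    then have "f \<in> A \<rightarrow> carrier R" "f x \<in> carrier R" using J.Icarr by blast+
    with insert show ?case by simp
  qed
qed

end

locale fiber_cone_setup = cring R for R (structure) +
  fixes M I
  assumes M: "ideal M R" and I: "ideal I R"
begin

abbreviation "Pn n \<equiv> ideal_pow R I n"
abbreviation "Qn n \<equiv> ideal_prod R M (ideal_pow R I n)"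

text \<open>The Rees algebra \<open>\<Oplus>\<^sub>n I\<^sup>n\<close>, as a subring of \<open>R[t]\<close>; the fiber cone is its image under
  the componentwise quotient map.\<close>

definition rees :: "(nat \<Rightarrow> 'a) set" where
  "rees = {p \<in> up R. \<forall>n. p n \<in> Pn n}"

definition proj :: "(nat \<Rightarrow> 'a) \<Rightarrow> nat \<Rightarrow> 'a set" where
  "proj p = (\<lambda>n. Qn n +> p n)"

lemma P_ideal: "ideal (Pn n) R" using I by (rule ideal_ideal_pow)
lemma Q_ideal: "ideal (Qn n) R" using M P_ideal by (rule ideal_prod_is_ideal)

lemma P_carr: "a \<in> Pn n \<Longrightarrow> a \<in> carrier R"
  using ideal.Icarr[OF P_ideal] by blast
lemma Q_carr: "a \<in> Qn n \<Longrightarrow> a \<in> carrier R"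
  using ideal.Icarr[OF Q_ideal] by blast

lemma P_mult: "a \<in> Pn i \<Longrightarrow> b \<in> Pn j \<Longrightarrow> a \<otimes> b \<in> Pn (i + j)"
  using ideal_prod.prod[of a "Pn i" b "Pn j" R] ideal_pow_add[OF I] by simp

lemma Q_mult:
  assumes "a \<in> Qn i" "b \<in> Pn j" shows "a \<otimes> b \<in> Qn (i + j)"
proof -
  have "a \<otimes> b \<in> ideal_prod R (Qn i) (Pn j)" using assms by (rule ideal_prod.prod)
  also have "\<dots> = ideal_prod R M (ideal_prod R (Pn i) (Pn j))"
    by (rule ideal_prod_assoc[OF M P_ideal P_ideal])
  finally show ?thesis by (simp add: ideal_pow_add[OF I])
qed

lemma Q_sub_P: "Qn n \<subseteq> Pn n"
  using ideal_prod_inter[OF M P_ideal] by blast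

lemma rcoset_mult_graded:
  assumes a: "a \<in> Pn i" and b: "b \<in> Pn j"
  shows "rcoset_mult R (Qn (i + j)) (Qn i +> a) (Qn j +> b) = Qn (i + j) +> (a \<otimes> b)"
proof -
  interpret Q: ideal "Qn (i + j)" R by (rule Q_ideal)
  have ca: "a \<in> carrier R" and cb: "b \<in> carrier R" using a b P_carr by auto
  have eq: "Qn (i + j) +> (a' \<otimes> b') = Qn (i + j) +> (a \<otimes> b)"
    if a': "a' \<in> Qn i +> a" and b': "b' \<in> Qn j +> b" for a' b'
  proof -
    from a' obtain q where q: "q \<in> Qn i" "a' = q \<oplus> a" by (auto simp: a_r_coset_def r_coset_def)
    from b' obtain s where s: "s \<in> Qn j" "b' = s \<oplus> b" by (auto simp: a_r_coset_def r_coset_def)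
    have c: "q \<in> carrier R" "s \<in> carrier R" using q s Q_carr by auto
    have sP: "s \<oplus> b \<in> Pn j"
      using s b Q_sub_P additive_subgroup.a_closed[OF ideal.axioms(1)[OF P_ideal]] by blast
    have 1: "q \<otimes> (s \<oplus> b) \<in> Qn (i + j)" using q(1) sP by (rule Q_mult)
    have 2: "a \<otimes> s \<in> Qn (i + j)"
      using Q_mult[OF s(1) a] ca c by (simp add: m_comm add.commute)
    have "a' \<otimes> b' = (q \<otimes> (s \<oplus> b) \<oplus> a \<otimes> s) \<oplus> a \<otimes> b"
      using q s ca cb c by algebra
    then have "a' \<otimes> b' \<in> Qn (i + j) +> (a \<otimes> b)"
      using Q.a_closed[OF 1 2] by (auto simp: a_r_coset_def r_coset_def)
    then show ?thesis using Q.a_repr_independence' ca cb by (metis m_closed)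
  qed
  have "a \<in> Qn i +> a" "b \<in> Qn j +> b"
    using ca cb additive_subgroup.zero_closed[OF ideal.axioms(1)[OF Q_ideal]]
    by (force simp: a_r_coset_def r_coset_def)+
  then show ?thesis unfolding rcoset_mult_def using eq by blast
qed

lemma cring_UP: "cring (UP R)"
  by (rule UP_cring.UP_cring) (rule UP_cring.intro, rule is_cring)

lemma UP_carr: "carrier (UP R) = up R" by (simp add: UP_def)
lemma UP_mult:
  "p \<in> up R \<Longrightarrow> q \<in> up R \<Longrightarrow> (p \<otimes>\<^bsub>UP R\<^esub> q) n = (\<Oplus>i\<in>{..n}. p i \<otimes> q (n - i))"
  by (simp add: UP_def)
lemma UP_add: "p \<in> up R \<Longrightarrow> q \<in> up R \<Longrightarrow> (p \<oplus>\<^bsub>UP R\<^esub> q) n = p n \<oplus> q n"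
  by (simp add: UP_def)
lemma UP_one: "\<one>\<^bsub>UP R\<^esub> n = (if n = 0 then \<one> else \<zero>)" by (simp add: UP_def)
lemma UP_zero: "\<zero>\<^bsub>UP R\<^esub> n = \<zero>" by (simp add: UP_def)

lemma P_zero: "\<zero> \<in> Pn n"
  using additive_subgroup.zero_closed[OF ideal.axioms(1)[OF P_ideal]] .

lemma UP_neg:
  assumes p: "p \<in> up R" shows "(\<ominus>\<^bsub>UP R\<^esub> p) n = \<ominus> p n" and "\<ominus>\<^bsub>UP R\<^esub> p \<in> up R"
proof -
  have pc: "p \<in> carrier (UP R)" using p by (simp only: UP_carr)
  note ag = abelian_group.a_inv_closed[OF ring.is_abelian_group[OF cring.axioms(1)[OF cring_UP]] pc]
    abelian_group.l_neg[OF ring.is_abelian_group[OF cring.axioms(1)[OF cring_UP]] pc]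
  show m: "\<ominus>\<^bsub>UP R\<^esub> p \<in> up R" using ag(1) by (simp only: UP_carr)
  have "(\<ominus>\<^bsub>UP R\<^esub> p) n \<oplus> p n = \<zero>"
    using UP_add[OF m p, of n] by (simp only: ag(2) UP_zero)
  then show "(\<ominus>\<^bsub>UP R\<^esub> p) n = \<ominus> p n" using mem_upD[OF m] mem_upD[OF p] minus_equality by metis
qed

lemma rees_subcring: "subcring rees (UP R)"
proof (rule cring.subcringI'[OF cring_UP], rule ring.subringI[OF cring.axioms(1)[OF cring_UP]])
  show "rees \<subseteq> carrier (UP R)" by (auto simp: rees_def UP_carr)
  have "\<one>\<^bsub>UP R\<^esub> \<in> up R"
    using monoid.one_closed[OF ring.is_monoid[OF cring.axioms(1)[OF cring_UP]]]
    by (simp only: UP_carr)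
  moreover have "\<one>\<^bsub>UP R\<^esub> n \<in> Pn n" for n
    using P_zero one_closed ideal_pow_0 by (cases "n = 0") (simp_all add: UP_one)
  ultimately show "\<one>\<^bsub>UP R\<^esub> \<in> rees" by (simp add: rees_def)
next
  fix p assume "p \<in> rees"
  then have pu: "p \<in> up R" and pP: "\<And>n. p n \<in> Pn n" by (auto simp: rees_def)
  have "\<ominus> p n \<in> Pn n" for n
    using pP additive_subgroup.a_inv_closed[OF ideal.axioms(1)[OF P_ideal]] by blast
  then show "\<ominus>\<^bsub>UP R\<^esub> p \<in> rees" using UP_neg[OF pu] by (simp add: rees_def)
next
  fix p q assume "p \<in> rees" "q \<in> rees"
  then have u: "p \<in> up R" "q \<in> up R" and P: "\<And>n. p n \<in> Pn n" "\<And>n. q n \<in> Pn n"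
    by (auto simp: rees_def)
  have uc: "p \<in> carrier (UP R)" "q \<in> carrier (UP R)" using u by (simp_all only: UP_carr)
  have pu: "p \<otimes>\<^bsub>UP R\<^esub> q \<in> up R"
    using monoid.m_closed[OF ring.is_monoid[OF cring.axioms(1)[OF cring_UP]] uc]
    by (simp only: UP_carr)
  have "p i \<otimes> q (n - i) \<in> Pn n" if "i \<le> n" for i n
    using P_mult[OF P(1)[of i] P(2)[of "n - i"]] that by simp
  then have "(\<Oplus>i\<in>{..n}. p i \<otimes> q (n - i)) \<in> Pn n" for n
    by (intro finsum_in_ideal[OF P_ideal]) auto
  then show "p \<otimes>\<^bsub>UP R\<^esub> q \<in> rees" using pu by (simp add: rees_def UP_mult[OF u])
  have su: "p \<oplus>\<^bsub>UP R\<^esub> q \<in> up R"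
    using abelian_monoid.a_closed[OF abelian_group.axioms(1)[OF
      ring.is_abelian_group[OF cring.axioms(1)[OF cring_UP]]] uc]
    by (simp only: UP_carr)
  have "p n \<oplus> q n \<in> Pn n" for n
    using P additive_subgroup.a_closed[OF ideal.axioms(1)[OF P_ideal]] by blast
  then show "p \<oplus>\<^bsub>UP R\<^esub> q \<in> rees" using su by (simp add: rees_def UP_add[OF u])
qed

lemma proj_hom: "proj \<in> ring_hom (UP R\<lparr>carrier := rees\<rparr>) (fiber_cone R M I)"
proof (rule ring_hom_memI)
  fix p assume p: "p \<in> carrier (UP R\<lparr>carrier := rees\<rparr>)"
  then have pu: "p \<in> up R" and pP: "\<And>n. p n \<in> Pn n" by (auto simp: rees_def)
  from pu obtain N where N: "bound \<zero> N p" by (auto simp: up_def)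
  have "proj p n = Qn n" if "n > N" for n
  proof -
    interpret Q: ideal "Qn n" R by (rule Q_ideal)
    show ?thesis using bound.bound[OF N that] Q.a_subset by (simp add: proj_def)
  qed
  then have "{n. proj p n \<noteq> Qn n} \<subseteq> {..N}" using leI by auto
  then have "finite {n. proj p n \<noteq> Qn n}" by (rule finite_subset) simp
  then show "proj p \<in> carrier (fiber_cone R M I)"
    using pP by (auto simp: fiber_cone_def proj_def)
next
  fix p q assume "p \<in> carrier (UP R\<lparr>carrier := rees\<rparr>)" "q \<in> carrier (UP R\<lparr>carrier := rees\<rparr>)"
  then have u: "p \<in> up R" "q \<in> up R" and P: "\<And>n. p n \<in> Pn n" "\<And>n. q n \<in> Pn n"
    by (auto simp: rees_def)
  have c: "p n \<in> carrier R" "q n \<in> carrier R" for n using u by auto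
  show "proj (p \<otimes>\<^bsub>UP R\<lparr>carrier := rees\<rparr>\<^esub> q) = proj p \<otimes>\<^bsub>fiber_cone R M I\<^esub> proj q"
  proof
    fix n
    interpret Q: ideal "Qn n" R by (rule Q_ideal)
    interpret h: ring_hom_cring R "R Quot Qn n" "(+>) (Qn n)"
      by (rule Q.rcos_ring_hom_cring) (rule is_cring)
    have t: "rcoset_mult R (Qn n) (proj p i) (proj q (n - i)) = Qn n +> (p i \<otimes> q (n - i))"
      if "i \<le> n" for i
      using rcoset_mult_graded[OF P(1) P(2), of i "n - i"] that by (simp add: proj_def)
    have "(proj p \<otimes>\<^bsub>fiber_cone R M I\<^esub> proj q) n =
        (\<Oplus>\<^bsub>R Quot Qn n\<^esub> i\<in>{..n}. rcoset_mult R (Qn n) (proj p i) (proj q (n - i)))"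
      by (simp add: fiber_cone_def)
    also have "\<dots> = (\<Oplus>\<^bsub>R Quot Qn n\<^esub> i\<in>{..n}. Qn n +> (p i \<otimes> q (n - i)))"
      by (rule h.S.finsum_cong') (use t c h.hom_closed in auto)
    also have "\<dots> = Qn n +> (\<Oplus>i\<in>{..n}. p i \<otimes> q (n - i))"
      using h.hom_finsum[of "\<lambda>i. p i \<otimes> q (n - i)" "{..n}"] c by (simp add: o_def)
    also have "\<dots> = proj (p \<otimes>\<^bsub>UP R\<lparr>carrier := rees\<rparr>\<^esub> q) n"
      using u by (simp add: proj_def UP_def)
    finally show "proj (p \<otimes>\<^bsub>UP R\<lparr>carrier := rees\<rparr>\<^esub> q) n = (proj p \<otimes>\<^bsub>fiber_cone R M I\<^esub> proj q) n"
      by simp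
  qed
  show "proj (p \<oplus>\<^bsub>UP R\<lparr>carrier := rees\<rparr>\<^esub> q) = proj p \<oplus>\<^bsub>fiber_cone R M I\<^esub> proj q"
  proof
    fix n
    interpret Q: ideal "Qn n" R by (rule Q_ideal)
    interpret h: ring_hom_cring R "R Quot Qn n" "(+>) (Qn n)"
      by (rule Q.rcos_ring_hom_cring) (rule is_cring)
    show "proj (p \<oplus>\<^bsub>UP R\<lparr>carrier := rees\<rparr>\<^esub> q) n = (proj p \<oplus>\<^bsub>fiber_cone R M I\<^esub> proj q) n"
      using u h.hom_add[OF c(1) c(2)] by (simp add: proj_def UP_def fiber_cone_def)
  qed
next
  show "proj \<one>\<^bsub>UP R\<lparr>carrier := rees\<rparr>\<^esub> = \<one>\<^bsub>fiber_cone R M I\<^esub>"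
  proof
    fix n
    interpret Q: ideal "Qn n" R by (rule Q_ideal)
    show "proj \<one>\<^bsub>UP R\<lparr>carrier := rees\<rparr>\<^esub> n = \<one>\<^bsub>fiber_cone R M I\<^esub> n"
      using Q.a_subset by (auto simp: proj_def UP_def fiber_cone_def)
  qed
qed

lemma proj_zero: "proj \<zero>\<^bsub>UP R\<^esub> = \<zero>\<^bsub>fiber_cone R M I\<^esub>"
proof
  fix n
  interpret Q: ideal "Qn n" R by (rule Q_ideal)
  show "proj \<zero>\<^bsub>UP R\<^esub> n = \<zero>\<^bsub>fiber_cone R M I\<^esub> n"
    using Q.a_subset by (simp add: proj_def UP_def fiber_cone_def)
qed

lemma proj_surj: "proj ` rees = carrier (fiber_cone R M I)"
proof
  show "proj ` rees \<subseteq> carrier (fiber_cone R M I)"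
    using ring_hom_memE(1)[OF proj_hom] by auto
  show "carrier (fiber_cone R M I) \<subseteq> proj ` rees"
  proof
    fix F assume "F \<in> carrier (fiber_cone R M I)"
    then have "\<forall>n. \<exists>a\<in>Pn n. F n = Qn n +> a" and fin: "finite {n. F n \<noteq> Qn n}"
      by (auto simp: fiber_cone_def)
    then obtain a where a: "\<And>n. a n \<in> Pn n" "\<And>n. F n = Qn n +> a n" by metis
    define p where "p = (\<lambda>n. if F n = Qn n then \<zero> else a n)"
    from fin obtain N where N: "\<And>n. F n \<noteq> Qn n \<Longrightarrow> n \<le> N"
      by (meson finite_nat_set_iff_bounded_le mem_Collect_eq)
    have "bound \<zero> N p" using N by (force simp: p_def)
    moreover have pP: "p n \<in> Pn n" for n
      using a additive_subgroup.zero_closed[OF ideal.axioms(1)[OF P_ideal]] by (simp add: p_def)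
    ultimately have "p \<in> rees" using P_carr by (auto simp: rees_def up_def)
    moreover have "proj p = F"
    proof
      fix n
      interpret Q: ideal "Qn n" R by (rule Q_ideal)
      show "proj p n = F n" using a Q.a_subset by (simp add: proj_def p_def)
    qed
    ultimately show "F \<in> proj ` rees" by blast
  qed
qed

theorem cring_fiber_cone: "cring (fiber_cone R M I)"
proof -
  interpret UP: cring "UP R" by (rule cring_UP)
  interpret A: cring "UP R\<lparr>carrier := rees\<rparr>"
    using UP.subcring_iff[OF subcringE(1)[OF rees_subcring]] rees_subcring by simp
  have "ring (fiber_cone R M I\<lparr>carrier := proj ` rees, zero := proj \<zero>\<^bsub>UP R\<^esub>\<rparr>)"
    using A.ring_hom_imp_img_ring[OF proj_hom] by simp
  then have "ring (fiber_cone R M I)" by (simp add: proj_surj proj_zero)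
  moreover have "x \<otimes>\<^bsub>fiber_cone R M I\<^esub> y = y \<otimes>\<^bsub>fiber_cone R M I\<^esub> x"
    if "x \<in> carrier (fiber_cone R M I)" "y \<in> carrier (fiber_cone R M I)" for x y
  proof -
    from that obtain p q where pq: "p \<in> rees" "q \<in> rees" "x = proj p" "y = proj q"
      using proj_surj by blast
    then show ?thesis
      using ring_hom_memE(2)[OF proj_hom, of p q] ring_hom_memE(2)[OF proj_hom, of q p]
        A.m_comm[of p q] by simp
  qed
  ultimately show ?thesis
    by (intro cring.intro comm_monoid.intro comm_monoid_axioms.intro) (auto dest: ring.axioms)
qed

end

lemma ideal_genideal_mpoly_ring:
  "ideal (genideal mpoly_ring A) (mpoly_ring :: ('x, 'k::comm_ring_1) mpoly ring)"
  by (rule ring.genideal_ideal[OF ring_from_type_algebra]) (simp add: ring_of_type_algebra_def)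

theorem cring_fiber_cone_mpoly_ring:
  assumes "ideal I (mpoly_ring :: ('x, 'k::comm_ring_1) mpoly ring)"
  shows "cring (fiber_cone mpoly_ring hom_max_ideal I)"
proof -
  have "ideal hom_max_ideal (mpoly_ring :: ('x, 'k) mpoly ring)"
    unfolding hom_max_ideal_def by (rule ideal_genideal_mpoly_ring)
  with assms have "fiber_cone_setup (mpoly_ring :: ('x, 'k) mpoly ring) hom_max_ideal I"
    by (intro fiber_cone_setup.intro fiber_cone_setup_axioms.intro cring_from_type_algebra)
  then show ?thesis by (rule fiber_cone_setup.cring_fiber_cone)
qed

end

theory Submission
  imports Defs "HOL-Library.Set_Algebras" "HOL-Analysis.Analysis"
begin

text \<open>A monomial ideal corresponds to an upward closed set of exponents, and
  \<open>I\<^sup>n\<close> is integrally closed iff it contains every monomial whose exponent \<open>u\<close> lies in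
  the Newton polyhedron \<open>\<Sum>\<^sub>j n\<^sub>j conv (G\<^sub>j) + \<real>\<^sub>\<ge>\<^sub>0\<^sup>d\<close>, where \<open>G\<^sub>j\<close> generates \<open>I\<^sub>j\<close>.
  Choose a minimal point \<open>v \<le> u\<close> of the polytope and write it as
  \<open>\<Sum>\<^sub>j \<Sum>\<^sub>g c\<^sub>j\<^sub>g g\<close> with \<open>\<Sum>\<^sub>g c\<^sub>j\<^sub>g = n\<^sub>j\<close> and minimal support. If some
  \<open>c\<^sub>j\<^sub>g \<ge> 1\<close>, then \<open>u - g\<close> lies in the polyhedron of a smaller exponent and induction applies.
  Otherwise each \<open>j\<close> with \<open>n\<^sub>j > 0\<close> contributes at least \<open>n\<^sub>j + 1\<close> generators, all of them on
  faces cut out by one strictly positive functional, and minimality of the support yields at least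
  \<open>|n|\<close> independent directions in the corresponding face of the product ideal. The monomials of
  that face span a quotient domain of the fiber cone with a chain of \<open>|n| + 2\<close> primes, so that
  \<open>|n| + 1 \<le> \<lambda>\<close> and \<open>I\<^sup>n\<close> is integrally closed by hypothesis.\<close>

text \<open>Where the bound comes from: of the n_j + 1 generators over an index, one is spent as the
  base point b_j, so it is the differences g - b_j that are counted. Exchanging one b_j for g in the
  sum of all base points stays on a face of the product ideal, which is why the analytic spread of
  the product is the right invariant. The degree of the Rees algebra is one more independent
  direction, hence the final + 1. No upper bound for the analytic spread is involved. Strict
  positivity of the functional is what kills m I^n, so that a face gives a quotient of the fiber
  cone. Minimality of v yields it because the polytope is finitely generated; for a disc, a minimal
  point may admit only functionals with a zero coordinate. The functionals that separate the primes
  are real and respect no lattice, so group rings with real exponents serve as targets. They are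
  domains because the exponents are totally ordered.\<close>

lemma type_ring_simps [simp]:
  "carrier ring_of_type_algebra = (UNIV :: 'a::comm_ring_1 set)"
  "(f :: 'a) \<otimes>\<^bsub>ring_of_type_algebra\<^esub> g = f * g"
  "f \<oplus>\<^bsub>ring_of_type_algebra\<^esub> g = f + g"
  "\<one>\<^bsub>ring_of_type_algebra\<^esub> = (1 :: 'a)"
  "\<zero>\<^bsub>ring_of_type_algebra\<^esub> = (0 :: 'a)"
  by (simp_all add: ring_of_type_algebra_def)

interpretation type_ring: cring "ring_of_type_algebra :: 'a::comm_ring_1 ring"
  by (rule cring_from_type_algebra)

lemma type_ring_pow [simp]: "(x :: 'a::comm_ring_1) [^]\<^bsub>ring_of_type_algebra\<^esub> (n::nat) = x ^ n"
  by (induction n) (simp_all add: mult.commute)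

lemma type_ring_finsum:
  "finite A \<Longrightarrow> finsum ring_of_type_algebra g A = (\<Sum>i\<in>A. g i :: 'a::comm_ring_1)"
  by (induction A rule: finite_induct) simp_all

lemma domain_type_ring: "domain (ring_of_type_algebra :: 'a::idom ring)"
  by (intro domain.intro domain_axioms.intro type_ring.is_cring) auto

lemma poly_mapping_sum_single: "(\<Sum>u\<in>Poly_Mapping.keys f. Poly_Mapping.single u (Poly_Mapping.lookup f u)) = f"
  by (rule poly_mapping_eqI)
     (simp add: lookup_sum lookup_single when_def sum.delta' in_keys_iff)

section \<open>Monomial ideals and upward closed sets of exponents\<close>

definition upset :: "('a::comm_monoid_add) set \<Rightarrow> bool" where
  "upset E \<longleftrightarrow> (\<forall>u\<in>E. \<forall>v. u + v \<in> E)"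

definition mspan :: "('x \<Rightarrow>\<^sub>0 nat) set \<Rightarrow> ('x, 'k::comm_ring_1) mpoly set" where
  "mspan E = {f. Poly_Mapping.keys f \<subseteq> E}"

lemma upset_UNIV [simp]: "upset UNIV" by (simp add: upset_def)

text \<open>Being upward closed becomes absorption of the summand \<open>UNIV\<close>, so later
  closure proofs are rewriting in the commutative monoid of sets.\<close>

lemma upset_iff_plus_UNIV: "upset E \<longleftrightarrow> E + UNIV = E"
proof
  assume "upset E"
  show "E + UNIV = E"
  proof
    show "E + UNIV \<subseteq> E" using \<open>upset E\<close> by (auto simp: upset_def elim: set_plus_elim)
    show "E \<subseteq> E + UNIV" using set_plus_intro[of _ E 0 UNIV] by auto
  qed
next
  assume "E + UNIV = E"
  then show "upset E" by (auto simp: upset_def intro: set_plus_intro)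
qed

lemma UNIV_plus_UNIV: "UNIV + UNIV = (UNIV :: 'a::comm_monoid_add set)"
  using upset_UNIV upset_iff_plus_UNIV by blast

lemma zero_in_mspan: "0 \<in> mspan E" by (simp add: mspan_def)

lemma mspan_add: "f \<in> mspan E \<Longrightarrow> g \<in> mspan E \<Longrightarrow> f + g \<in> mspan E"
  using Poly_Mapping.keys_add[of f g] by (auto simp: mspan_def)

lemma mspan_mult: "f \<in> mspan E \<Longrightarrow> g \<in> mspan F \<Longrightarrow> f * g \<in> mspan (E + F)"
  using Poly_Mapping.keys_mult[of f g] by (force simp: mspan_def set_plus_def)

lemma mspan_uminus: "f \<in> mspan E \<Longrightarrow> - f \<in> mspan E"
  by (auto simp: mspan_def in_keys_iff)

lemma single_in_mspan: "u \<in> E \<Longrightarrow> Poly_Mapping.single u c \<in> mspan E"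
  by (auto simp: mspan_def)

lemma monomial_in_mspan_iff [simp]:
  "(monomial u :: ('x, 'k::comm_ring_1) mpoly) \<in> mspan E \<longleftrightarrow> u \<in> E"
  by (simp add: monomial_def mspan_def)

lemma mspan_ideal:
  assumes "upset E"
  shows "ideal (mspan E :: ('x, 'k::comm_ring_1) mpoly set) mpoly_ring"
proof (rule idealI, rule type_ring.ring_axioms)
  show "subgroup (mspan E :: ('x, 'k) mpoly set) (add_monoid mpoly_ring)"
  proof (rule subgroup.intro)
    fix f :: "('x, 'k) mpoly" assume "f \<in> mspan E"
    moreover have "inv\<^bsub>add_monoid mpoly_ring\<^esub> f = - f"
      using type_ring.minus_equality[of "- f" f] by (simp add: a_inv_def)
    ultimately show "inv\<^bsub>add_monoid mpoly_ring\<^esub> f \<in> mspan E" by (simp add: mspan_uminus)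
  qed (auto simp: zero_in_mspan mspan_add)
next
  fix f g :: "('x, 'k) mpoly" assume f: "f \<in> mspan E"
  have "f * g \<in> mspan (E + UNIV)" using f by (rule mspan_mult) (simp add: mspan_def)
  then have "f * g \<in> mspan E" using assms by (simp add: upset_iff_plus_UNIV)
  then show "g \<otimes>\<^bsub>mpoly_ring\<^esub> f \<in> mspan E" "f \<otimes>\<^bsub>mpoly_ring\<^esub> g \<in> mspan E" by (simp_all add: mult.commute)
qed

text \<open>A polynomial is the sum of its terms, so an additively closed set with all terms over
  \<open>E\<close> exhausts \<open>mspan E\<close>. Generated ideals and products of ideals are both
  identified in this way.\<close>

lemma mspan_eqI:
  fixes J :: "('x, 'k::comm_ring_1) mpoly set"
  assumes "J \<subseteq> mspan E"
    and "\<And>f g. f \<in> J \<Longrightarrow> g \<in> J \<Longrightarrow> f + g \<in> J" and "0 \<in> J"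
    and "\<And>u c. u \<in> E \<Longrightarrow> Poly_Mapping.single u c \<in> J"
  shows "J = mspan E"
proof
  have "sum h A \<in> J" if "\<And>i. i \<in> A \<Longrightarrow> h i \<in> J" for h and A :: "('x \<Rightarrow>\<^sub>0 nat) set"
    using that by (induction A rule: infinite_finite_induct) (auto simp: assms)
  moreover have "f = (\<Sum>u\<in>Poly_Mapping.keys f. Poly_Mapping.single u (Poly_Mapping.lookup f u))"
    for f :: "('x, 'k) mpoly" by (simp add: poly_mapping_sum_single)
  ultimately show "mspan E \<subseteq> J" using assms(4) unfolding mspan_def
    by (metis (no_types, lifting) mem_Collect_eq subsetD subsetI)
qed (fact assms(1))

lemma genideal_monomials:
  "genideal mpoly_ring (monomial ` U) = (mspan (U + UNIV) :: ('x, 'k::comm_ring_1) mpoly set)"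
proof (rule mspan_eqI)
  let ?J = "genideal mpoly_ring (monomial ` U) :: ('x, 'k) mpoly set"
  interpret J: ideal ?J "mpoly_ring :: ('x, 'k) mpoly ring"
    by (rule ideal_genideal_mpoly_ring)
  have "upset (U + UNIV)" by (simp add: upset_iff_plus_UNIV add.assoc UNIV_plus_UNIV)
  moreover have "monomial ` U \<subseteq> (mspan (U + UNIV) :: ('x, 'k) mpoly set)"
    using set_plus_intro[of _ U 0 UNIV] by auto
  ultimately show "?J \<subseteq> mspan (U + UNIV)" by (intro type_ring.genideal_minimal mspan_ideal)
  show "f + g \<in> ?J" if "f \<in> ?J" "g \<in> ?J" for f g using J.a_closed[OF that] by simp
  show "0 \<in> ?J" using J.zero_closed by simp
  fix u c assume "u \<in> U + UNIV"
  then obtain a b where ab: "a \<in> U" "u = a + b" by (auto elim: set_plus_elim)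
  then have "monomial a \<in> ?J" using type_ring.genideal_self[of "monomial ` U"] by auto
  from J.I_l_closed[OF this, of "Poly_Mapping.single b c"] ab
  show "Poly_Mapping.single u c \<in> ?J" by (simp add: monomial_def mult_single add.commute)
qed

lemma monomial_idealE:
  assumes "monomial_ideal I"
  obtains E where "upset E" "I = mspan E"
proof -
  obtain U where "I = mspan (U + UNIV)"
    using assms unfolding monomial_ideal_def genideal_monomials by blast
  moreover have "upset (U + UNIV)" by (simp add: upset_iff_plus_UNIV add.assoc UNIV_plus_UNIV)
  ultimately show thesis using that by blast
qed

lemma ideal_prod_mspan:
  "ideal_prod mpoly_ring (mspan E) (mspan F) = (mspan (E + F) :: ('x, 'k::comm_ring_1) mpoly set)"
proof (rule mspan_eqI)
  let ?P = "ideal_prod mpoly_ring (mspan E) (mspan F) :: ('x, 'k) mpoly set"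
  show "?P \<subseteq> mspan (E + F)"
  proof
    fix f :: "('x, 'k) mpoly" assume "f \<in> ?P"
    then show "f \<in> mspan (E + F)" by (induction rule: ideal_prod.induct) (auto simp: mspan_add mspan_mult)
  qed
  show "f + g \<in> ?P" if "f \<in> ?P" "g \<in> ?P" for f g using ideal_prod.sum[OF that] by simp
  show "0 \<in> ?P" using ideal_prod.prod[OF zero_in_mspan zero_in_mspan, of mpoly_ring E F] by simp
  fix u c assume "u \<in> E + F"
  then obtain a b where ab: "a \<in> E" "b \<in> F" "u = a + b" by (auto elim: set_plus_elim)
  from ideal_prod.prod[OF single_in_mspan[OF ab(1), of 1] single_in_mspan[OF ab(2), of c], of mpoly_ring]
  show "Poly_Mapping.single u c \<in> ?P" using ab by (simp add: mult_single)
qed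

lemma mspan_UNIV [simp]: "mspan UNIV = UNIV" by (simp add: mspan_def)

section \<open>Power products\<close>

text \<open>The summand \<open>UNIV\<close> makes the empty product the unit ideal, where the bare
  sum would be \<open>{0}\<close>, and makes every power upward closed whether or not
  \<open>E\<close> is.\<close>

definition npow :: "('a::comm_monoid_add) set \<Rightarrow> nat \<Rightarrow> 'a set" where
  "npow E n = UNIV + (\<Sum>i<n. E)"

definition ppow :: "'j set \<Rightarrow> ('j \<Rightarrow> ('a::comm_monoid_add) set) \<Rightarrow> ('j \<Rightarrow> nat) \<Rightarrow> 'a set" where
  "ppow A E n = UNIV + (\<Sum>j\<in>A. \<Sum>i<n j. E j)"

lemma upset_npow [simp]: "upset (npow E n)"
  by (simp add: upset_iff_plus_UNIV npow_def add.assoc[of UNIV _ UNIV] add.commute[of _ UNIV])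
     (simp add: UNIV_plus_UNIV flip: add.assoc)

lemma upset_ppow [simp]: "upset (ppow A E n)"
  by (simp add: upset_iff_plus_UNIV ppow_def add.assoc[of UNIV _ UNIV] add.commute[of _ UNIV])
     (simp add: UNIV_plus_UNIV flip: add.assoc)

lemma npow_0 [simp]: "npow E 0 = UNIV" by (simp add: npow_def flip: set_zero)

lemma npow_Suc: "npow E (Suc n) = npow E n + E"
  by (simp add: npow_def add.assoc)

lemma npow_add: "npow E (m + n) = npow E m + npow E n"
proof (induction n)
  case 0 show ?case using upset_npow[of E m] by (simp only: upset_iff_plus_UNIV npow_0 add_0_right)
next
  case (Suc n) then show ?case by (simp add: npow_Suc add.assoc)
qed

lemma npow_plus: "npow (E + F) n = npow E n + npow F n"
proof (induction n)
  case 0 show ?case by (simp add: UNIV_plus_UNIV)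
next
  case (Suc n) then show ?case by (simp add: npow_Suc ac_simps)
qed

lemma npow_1 [simp]: "upset E \<Longrightarrow> npow E (Suc 0) = E"
  by (simp add: npow_Suc upset_iff_plus_UNIV add.commute)

lemma npow_UNIV [simp]: "npow UNIV n = UNIV"
  by (induction n) (simp_all add: npow_Suc UNIV_plus_UNIV)

lemma ppow_insert:
  assumes "finite A" "j \<notin> A"
  shows "ppow (insert j A) E n = npow (E j) (n j) + ppow A E n"
proof -
  have "npow (E j) (n j) + ppow A E n = (UNIV + UNIV) + ((\<Sum>i<n j. E j) + (\<Sum>j\<in>A. \<Sum>i<n j. E j))"
    unfolding npow_def ppow_def by (simp only: ac_simps)
  then show ?thesis using assms by (simp add: ppow_def UNIV_plus_UNIV)
qed

lemma ppow_empty [simp]: "ppow {} E n = UNIV" by (simp add: ppow_def flip: set_zero)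

lemma npow_npow: "npow (npow E n) m = npow E (m * n)"
  by (induction m) (simp_all add: npow_Suc npow_add add.commute)

lemma npow_ppow:
  assumes "finite A" shows "npow (ppow A E n) m = ppow A E (\<lambda>j. m * n j)"
  using assms by (induction A rule: finite_induct) (simp_all add: ppow_insert npow_plus npow_npow)

lemma ppow_add_index:
  assumes "finite A" "j \<in> A"
  shows "ppow A E (n(j := Suc (n j))) = ppow A E n + E j"
proof -
  have A: "A = insert j (A - {j})" and nj: "j \<notin> A - {j}" using assms by auto
  have eq: "ppow (A - {j}) E (n(j := Suc (n j))) = ppow (A - {j}) E n" by (simp add: ppow_def)
  have "ppow (insert j (A - {j})) E (n(j := Suc (n j))) = ppow (insert j (A - {j})) E n + E j"
    unfolding ppow_insert[OF finite_Diff[OF assms(1)] nj] eq by (simp add: npow_Suc ac_simps)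
  then show ?thesis by (simp only: flip: A)
qed

lemma ideal_pow_mspan:
  "ideal_pow mpoly_ring (mspan E) n = (mspan (npow E n) :: ('x, 'k::comm_ring_1) mpoly set)"
proof (induction n)
  case 0 show ?case by (simp only: type_ring.ideal_pow_0 npow_0 mspan_UNIV type_ring_simps)
next
  case (Suc n)
  have "ideal_pow mpoly_ring (mspan E :: ('x, 'k) mpoly set) (Suc n) =
      ideal_prod mpoly_ring (ideal_pow mpoly_ring (mspan E) n) (mspan E)"
    by (simp add: ideals_set_def)
  then show ?case by (simp add: Suc ideal_prod_mspan npow_Suc)
qed

lemma ideals_set_mult_mspan:
  "mspan E \<otimes>\<^bsub>ideals_set mpoly_ring\<^esub> mspan F = (mspan (E + F) :: ('x, 'k::comm_ring_1) mpoly set)"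
  by (simp add: ideals_set_def ideal_prod_mspan)

lemma power_product_mspan:
  assumes I: "\<And>j. j \<in> {1..r} \<Longrightarrow> I j = (mspan (E j) :: ('x, 'k::comm_ring_1) mpoly set)"
  shows "power_product mpoly_ring r I n = mspan (ppow {1..r} E n)"
proof -
  interpret S: comm_monoid "ideals_set (mpoly_ring :: ('x, 'k) mpoly ring)"
    by (rule type_ring.ideals_set_is_comm_monoid)
  have "(\<Otimes>\<^bsub>ideals_set mpoly_ring\<^esub> j\<in>A. ideal_pow mpoly_ring (I j) (n j)) = mspan (ppow A E n)"
    if "finite A" "A \<subseteq> {1..r}" for A
    using that
  proof (induction A rule: finite_induct)
    case empty show ?case by (simp only: S.finprod_empty ppow_empty) (simp add: ideals_set_def)
  next
    case (insert a A)
    have car: "(mspan (npow (E j) (n j)) :: ('x, 'k) mpoly set) \<in> carrier (ideals_set mpoly_ring)" for j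
      by (simp add: ideals_set_def mspan_ideal)
    have "(\<lambda>j. ideal_pow mpoly_ring (I j) (n j)) \<in> A \<rightarrow> carrier (ideals_set mpoly_ring)"
      using insert.prems car by (auto simp: I ideal_pow_mspan subset_iff simp del: S.nat_pow_closed)
    with insert car show ?case
      by (simp add: I ideal_pow_mspan ppow_insert ideals_set_mult_mspan)
  qed
  then show ?thesis unfolding power_product_def by simp
qed

lemma finprod_mspan:
  fixes r :: nat
  assumes I: "\<And>j. j \<in> {1..r} \<Longrightarrow> I j = (mspan (E j) :: ('x, 'k::comm_ring_1) mpoly set)"
    and E: "\<And>j. j \<in> {1..r} \<Longrightarrow> upset (E j)"
  shows "(\<Otimes>\<^bsub>ideals_set mpoly_ring\<^esub> j\<in>{1..r}. I j) = mspan (ppow {1..r} E (\<lambda>_. 1))"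
proof -
  interpret S: comm_monoid "ideals_set (mpoly_ring :: ('x, 'k) mpoly ring)"
    by (rule type_ring.ideals_set_is_comm_monoid)
  have "I j \<in> carrier (ideals_set mpoly_ring)" if "j \<in> {1..r}" for j
    using that by (simp add: I E ideals_set_def mspan_ideal)
  then have "(\<Otimes>\<^bsub>ideals_set mpoly_ring\<^esub> j\<in>{1..r}. I j) = power_product mpoly_ring r I (\<lambda>_. 1)"
    unfolding power_product_def by (intro S.finprod_cong') auto
  also have "\<dots> = mspan (ppow {1..r} E (\<lambda>_. 1))" by (rule power_product_mspan) (rule I)
  finally show ?thesis .
qed

section \<open>A lower bound for the analytic spread\<close>

definition mlin :: "('a \<Rightarrow> 'c \<Rightarrow> 'd::comm_monoid_add) \<Rightarrow> ('a \<Rightarrow>\<^sub>0 'c::zero) \<Rightarrow> 'd" where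
  "mlin \<phi> f = (\<Sum>u\<in>Poly_Mapping.keys f. \<phi> u (Poly_Mapping.lookup f u))"

lemma mlin_0 [simp]: "mlin \<phi> 0 = 0" by (simp add: mlin_def)

lemma mlin_superset:
  assumes "\<And>u. \<phi> u 0 = 0" "finite A" "Poly_Mapping.keys f \<subseteq> A"
  shows "mlin \<phi> f = (\<Sum>u\<in>A. \<phi> u (Poly_Mapping.lookup f u))"
  unfolding mlin_def using assms by (intro sum.mono_neutral_left) (auto simp: in_keys_iff)

lemma mlin_single:
  assumes "\<And>u. \<phi> u 0 = 0" shows "mlin \<phi> (Poly_Mapping.single u c) = \<phi> u c"
  using mlin_superset[of \<phi> "{u}" "Poly_Mapping.single u c"] assms by simp

lemma mlin_add:
  assumes "\<And>u. \<phi> u 0 = 0" "\<And>u a b. \<phi> u (a + b) = \<phi> u a + \<phi> u b"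
  shows "mlin \<phi> (f + g) = mlin \<phi> f + mlin \<phi> g"
proof -
  let ?A = "Poly_Mapping.keys f \<union> Poly_Mapping.keys g"
  have "Poly_Mapping.keys (f + g) \<subseteq> ?A" by (rule Poly_Mapping.keys_add)
  then show ?thesis
    using mlin_superset[of \<phi> ?A f] mlin_superset[of \<phi> ?A g] mlin_superset[of \<phi> ?A "f + g"]
    by (simp add: assms lookup_add sum.distrib)
qed

lemma mlin_sum:
  assumes "\<And>u. \<phi> u 0 = 0" "\<And>u a b. \<phi> u (a + b) = \<phi> u a + \<phi> u b"
  shows "mlin \<phi> (\<Sum>i\<in>A. f i) = (\<Sum>i\<in>A. mlin \<phi> (f i))"
  by (induction A rule: infinite_finite_induct) (simp_all add: mlin_add[of \<phi>, OF assms])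

text \<open>By \<open>ker\<close>, \<open>\<psi>\<close> factors through the surjection
  \<open>\<pi>\<close>, and the kernel of the induced map into the domain \<open>T\<close> is prime.
  Thus maps out of the fiber cone, whose elements are sequences of cosets, can be given on the Rees
  algebra.\<close>

lemma primeideal_of_factor_hom:
  assumes A: "cring A" and B: "cring B" and T: "domain T"
    and \<pi>: "\<pi> \<in> ring_hom A B" "\<pi> ` carrier A = carrier B"
    and \<psi>: "\<psi> \<in> ring_hom A T"
    and ker: "\<And>x. x \<in> carrier A \<Longrightarrow> \<pi> x = \<zero>\<^bsub>B\<^esub> \<Longrightarrow> \<psi> x = \<zero>\<^bsub>T\<^esub>"
  defines "P \<equiv> \<pi> ` {x \<in> carrier A. \<psi> x = \<zero>\<^bsub>T\<^esub>}"
  shows "primeideal P B" and "\<And>x. x \<in> carrier A \<Longrightarrow> \<pi> x \<in> P \<longleftrightarrow> \<psi> x = \<zero>\<^bsub>T\<^esub>"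
proof -
  interpret A: cring A by fact
  interpret B: cring B by fact
  interpret T: domain T by fact
  interpret \<pi>: ring_hom_cring A B \<pi>
    using \<pi>(1) by unfold_locales
  interpret \<psi>: ring_hom_cring A T \<psi>
    using \<psi>(1) by unfold_locales
  have eq: "\<psi> x = \<psi> y" if "x \<in> carrier A" "y \<in> carrier A" "\<pi> x = \<pi> y" for x y
  proof -
    have "\<pi> (x \<oplus>\<^bsub>A\<^esub> \<ominus>\<^bsub>A\<^esub> y) = \<zero>\<^bsub>B\<^esub>" using that B.r_neg by simp
    then have "\<psi> (x \<oplus>\<^bsub>A\<^esub> \<ominus>\<^bsub>A\<^esub> y) = \<zero>\<^bsub>T\<^esub>" using that by (intro ker) auto
    then have "\<psi> x \<oplus>\<^bsub>T\<^esub> \<ominus>\<^bsub>T\<^esub> \<psi> y = \<zero>\<^bsub>T\<^esub>" using that by simp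
    then show ?thesis using that T.r_right_minus_eq[of "\<psi> x" "\<psi> y"] by (simp add: a_minus_def)
  qed
  \<comment> \<open>The induced map uses chosen preimages; \<open>eq\<close> makes the choice
    irrelevant.\<close>
  define \<rho> where "\<rho> b = \<psi> (inv_into (carrier A) \<pi> b)" for b
  have \<rho>: "\<rho> (\<pi> x) = \<psi> x" if "x \<in> carrier A" for x
    unfolding \<rho>_def using that by (intro eq inv_into_into) (auto intro: f_inv_into_f)
  have sur: "\<exists>x\<in>carrier A. b = \<pi> x" if "b \<in> carrier B" for b
    using that \<pi>(2) by blast
  have "\<rho> \<in> ring_hom B T"
  proof (rule ring_hom_memI)
    fix b c assume bc: "b \<in> carrier B" "c \<in> carrier B"
    obtain x where "x \<in> carrier A" "b = \<pi> x" using sur[OF bc(1)] ..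
    moreover obtain y where "y \<in> carrier A" "c = \<pi> y" using sur[OF bc(2)] ..
    ultimately
    show "\<rho> (b \<otimes>\<^bsub>B\<^esub> c) = \<rho> b \<otimes>\<^bsub>T\<^esub> \<rho> c" "\<rho> (b \<oplus>\<^bsub>B\<^esub> c) = \<rho> b \<oplus>\<^bsub>T\<^esub> \<rho> c"
      using \<rho>[of "x \<otimes>\<^bsub>A\<^esub> y"] \<rho>[of "x \<oplus>\<^bsub>A\<^esub> y"] \<rho>[of x] \<rho>[of y] by auto
  next
    show "\<rho> b \<in> carrier T" if "b \<in> carrier B" for b using sur[OF that] \<rho> by auto
    show "\<rho> \<one>\<^bsub>B\<^esub> = \<one>\<^bsub>T\<^esub>" using \<rho>[of "\<one>\<^bsub>A\<^esub>"] by simp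
  qed
  then interpret \<rho>: ring_hom_ring B T \<rho>
    by (intro ring_hom_ringI2 B.ring_axioms T.ring_axioms)
  have P: "P = {b \<in> carrier B. \<rho> b \<in> {\<zero>\<^bsub>T\<^esub>}}"
    unfolding P_def \<pi>(2)[symmetric] using \<rho> by auto
  show "primeideal P B" unfolding P by (rule \<rho>.primeideal_vimage[OF B T.zeroprimeideal])
  show "\<pi> x \<in> P \<longleftrightarrow> \<psi> x = \<zero>\<^bsub>T\<^esub>" if "x \<in> carrier A" for x
    unfolding P using that \<rho> by simp
qed

lemma hom_max_ideal_mspan:
  "(hom_max_ideal :: ('x, 'k::comm_ring_1) mpoly set) =
     mspan (range (\<lambda>i. Poly_Mapping.single i 1) + UNIV)"
  unfolding hom_max_ideal_def genideal_monomials[symmetric] image_image ..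

text \<open>The monomials \<open>X\<^sup>u t\<^sup>n\<close> of the Rees algebra with \<open>\<delta> u n = 0\<close> span a quotient of the fiber
  cone that is an affine semigroup ring, and the first \<open>i\<close> functionals \<open>h\<close> map it to the group
  ring of \<open>\<real>\<^sup>i\<close>. The kernels of these maps form a chain of primes.\<close>

locale exponent_face =
  fixes E :: "('x \<Rightarrow>\<^sub>0 nat) set" and \<delta> :: "('x \<Rightarrow>\<^sub>0 nat) \<Rightarrow> nat \<Rightarrow> real"
    and h :: "nat \<Rightarrow> ('x \<Rightarrow>\<^sub>0 nat) \<Rightarrow> nat \<Rightarrow> real" and e :: "nat \<Rightarrow> ('x \<Rightarrow>\<^sub>0 nat)" and s :: nat
    and K :: "'k::field itself"
  assumes upset: "upset E"
    and \<delta>_add: "\<delta> (u + v) (a + b) = \<delta> u a + \<delta> v b"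
    and \<delta>_nonneg: "u \<in> npow E n \<Longrightarrow> 0 \<le> \<delta> u n"
    and \<delta>_pos: "0 < \<delta> (Poly_Mapping.single x 1) 0"
    and h_add: "h l (u + v) (a + b) = h l u a + h l v b"
    and e_in: "i < s \<Longrightarrow> e i \<in> E"
    and \<delta>_e: "i < s \<Longrightarrow> \<delta> (e i) 1 = 0"
    and h_e: "i < s \<Longrightarrow> l < s \<Longrightarrow> h l (e i) 1 = (if l = i then 1 else 0)"
begin

text \<open>All spaces R^i sit inside one exponent type, whose lexicographic total order makes the
  group ring a domain.\<close>

definition hvec :: "nat \<Rightarrow> ('x \<Rightarrow>\<^sub>0 nat) \<Rightarrow> nat \<Rightarrow> (nat \<Rightarrow>\<^sub>0 real)" where
  "hvec i u n = (\<Sum>l<i. Poly_Mapping.single l (h l u n))"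

definition \<psi> :: "nat \<Rightarrow> nat \<Rightarrow> ('x, 'k) mpoly \<Rightarrow> ((nat \<Rightarrow>\<^sub>0 real) \<Rightarrow>\<^sub>0 'k)" where
  "\<psi> i n = mlin (\<lambda>u c. if \<delta> u n = 0 then Poly_Mapping.single (hvec i u n) c else 0)"

lemma hvec_add: "hvec i (u + v) (a + b) = hvec i u a + hvec i v b"
  by (simp add: hvec_def h_add single_add sum.distrib)

lemma hvec_0: "hvec i 0 0 = 0"
  using hvec_add[of i 0 0 0 0] by simp

lemma lookup_hvec: "Poly_Mapping.lookup (hvec i u n) l = (if l < i then h l u n else 0)"
  by (simp add: hvec_def lookup_sum lookup_single when_def)

lemma \<delta>_0: "\<delta> 0 0 = 0" using \<delta>_add[of 0 0 0 0] by simp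

lemma \<psi>_add: "\<psi> i n (f + g) = \<psi> i n f + \<psi> i n g"
  unfolding \<psi>_def by (rule mlin_add) (auto simp: single_add)

lemma \<psi>_sum: "\<psi> i n (\<Sum>j\<in>A. f j) = (\<Sum>j\<in>A. \<psi> i n (f j))"
  unfolding \<psi>_def by (rule mlin_sum) (auto simp: single_add)

lemma \<psi>_0 [simp]: "\<psi> i n 0 = 0" by (simp add: \<psi>_def)

lemma \<psi>_single: "\<psi> i n (Poly_Mapping.single u c) =
    (if \<delta> u n = 0 then Poly_Mapping.single (hvec i u n) c else 0)"
  unfolding \<psi>_def by (subst mlin_single) auto

lemma \<psi>_1: "\<psi> i 0 1 = 1"
  using \<psi>_single[of i 0 0 1] by (simp add: \<delta>_0 hvec_0)

text \<open>Since \<open>\<delta>\<close> is nonnegative on both powers, it vanishes on a sum of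
  exponents only if it vanishes on each: a product with a factor off the face stays off the
  face.\<close>

lemma \<psi>_mult:
  assumes "f \<in> mspan (npow E a)" "g \<in> mspan (npow E b)"
  shows "\<psi> i (a + b) (f * g) = \<psi> i a f * \<psi> i b g"
proof -
  let ?s = "\<lambda>f u. Poly_Mapping.single u (Poly_Mapping.lookup f u)"
  have *: "\<psi> i (a + b) (?s f u * ?s g v) = \<psi> i a (?s f u) * \<psi> i b (?s g v)"
    if "u \<in> Poly_Mapping.keys f" "v \<in> Poly_Mapping.keys g" for u v
  proof -
    have "0 \<le> \<delta> u a" "0 \<le> \<delta> v b" using that assms by (auto simp: mspan_def intro!: \<delta>_nonneg)
    then have "\<delta> (u + v) (a + b) = 0 \<longleftrightarrow> \<delta> u a = 0 \<and> \<delta> v b = 0" by (auto simp: \<delta>_add)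
    then show ?thesis by (simp add: mult_single \<psi>_single hvec_add)
  qed
  have "f * g = (\<Sum>u\<in>Poly_Mapping.keys f. \<Sum>v\<in>Poly_Mapping.keys g. ?s f u * ?s g v)"
    by (simp add: poly_mapping_sum_single flip: sum_product)
  then have "\<psi> i (a + b) (f * g) =
      (\<Sum>u\<in>Poly_Mapping.keys f. \<Sum>v\<in>Poly_Mapping.keys g. \<psi> i a (?s f u) * \<psi> i b (?s g v))"
    by (simp add: \<psi>_sum *)
  also have "\<dots> = \<psi> i a (\<Sum>u\<in>Poly_Mapping.keys f. ?s f u) * \<psi> i b (\<Sum>v\<in>Poly_Mapping.keys g. ?s g v)"
    by (simp add: \<psi>_sum sum_product)
  finally show ?thesis by (simp add: poly_mapping_sum_single)
qed

text \<open>A variable raises \<open>\<delta>\<close> strictly, so no exponent of m I^n lies on the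
  face. This is what lets \<open>\<psi>\<close> descend to the fiber cone.\<close>

lemma \<psi>_eq_0:
  assumes "f \<in> mspan (range (\<lambda>i. Poly_Mapping.single i 1) + UNIV + npow E n)"
  shows "\<psi> i n f = 0"
proof -
  have "\<delta> u n > 0" if u: "u \<in> Poly_Mapping.keys f" for u
  proof -
    have "range (\<lambda>i. Poly_Mapping.single i 1) + UNIV + npow E n =
        range (\<lambda>i. Poly_Mapping.single i 1) + npow E n"
      using upset_npow[of E n] by (simp add: upset_iff_plus_UNIV add.assoc add.commute[of UNIV])
    then obtain j v where "u = Poly_Mapping.single j 1 + v" "v \<in> npow E n"
      using assms u by (auto simp: mspan_def elim!: set_plus_elim)
    then show ?thesis
      using \<delta>_add[of "Poly_Mapping.single j 1" v 0 n] \<delta>_pos[of j] \<delta>_nonneg[of v n] by simp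
  qed
  then show ?thesis unfolding \<psi>_def mlin_def by (intro sum.neutral) force
qed

lemma fiber_setup:
  "fiber_cone_setup (mpoly_ring :: ('x, 'k) mpoly ring) hom_max_ideal (mspan E)"
  using upset by (intro fiber_cone_setup.intro fiber_cone_setup_axioms.intro type_ring.is_cring mspan_ideal)
     (simp_all add: hom_max_ideal_def ideal_genideal_mpoly_ring)

sublocale fiber: fiber_cone_setup "mpoly_ring :: ('x, 'k) mpoly ring" hom_max_ideal "mspan E"
  by (rule fiber_setup)

lemma reesD:
  assumes "p \<in> fiber.rees"
  shows "p \<in> up mpoly_ring" "p n \<in> mspan (npow E n)" "\<exists>N. \<forall>n>N. p n = 0"
  using assms by (auto simp: fiber.rees_def ideal_pow_mspan up_def bound_def)

text \<open>Keeping the degrees apart in a polynomial reduces multiplicativity to a comparison of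
  coefficients.\<close>

definition \<Psi>_poly :: "nat \<Rightarrow> (nat \<Rightarrow> ('x, 'k) mpoly) \<Rightarrow> ((nat \<Rightarrow>\<^sub>0 real) \<Rightarrow>\<^sub>0 'k) poly" where
  "\<Psi>_poly i p = Abs_poly (\<lambda>n. \<psi> i n (p n))"

text \<open>Evaluation at 1 forgets the degree; that is why the functionals \<open>h\<close> take
  \<open>n\<close> as an argument and can record it.\<close>

definition \<Psi> :: "nat \<Rightarrow> (nat \<Rightarrow> ('x, 'k) mpoly) \<Rightarrow> ((nat \<Rightarrow>\<^sub>0 real) \<Rightarrow>\<^sub>0 'k)" where
  "\<Psi> i p = poly (\<Psi>_poly i p) 1"

lemma coeff_\<Psi>_poly:
  assumes "p \<in> fiber.rees" shows "coeff (\<Psi>_poly i p) n = \<psi> i n (p n)"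
proof -
  obtain N where "\<forall>n>N. p n = 0" using reesD(3)[OF assms] by blast
  then show ?thesis unfolding \<Psi>_poly_def by (subst coeff_Abs_poly[of N]) auto
qed

lemma \<Psi>_eq_sum:
  assumes "p \<in> fiber.rees" "\<And>n. n > N \<Longrightarrow> p n = 0"
  shows "\<Psi> i p = (\<Sum>n\<le>N. \<psi> i n (p n))"
proof -
  have "degree (\<Psi>_poly i p) \<le> N"
    by (rule degree_le) (simp add: coeff_\<Psi>_poly[OF assms(1)] assms(2))
  then have "(\<Sum>n\<le>degree (\<Psi>_poly i p). coeff (\<Psi>_poly i p) n) = (\<Sum>n\<le>N. coeff (\<Psi>_poly i p) n)"
    by (intro sum.mono_neutral_left) (auto simp: coeff_eq_0)
  then show ?thesis
    unfolding \<Psi>_def by (simp add: poly_altdef coeff_\<Psi>_poly[OF assms(1)])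
qed

abbreviation "rees_ring \<equiv> (UP mpoly_ring)\<lparr>carrier := fiber.rees\<rparr>"

lemma cring_rees_ring: "cring rees_ring"
proof -
  interpret UP: cring "UP (mpoly_ring :: ('x, 'k) mpoly ring)" by (rule fiber.cring_UP)
  show ?thesis
    using UP.subcring_iff[OF subcringE(1)[OF fiber.rees_subcring]] fiber.rees_subcring by simp
qed

lemma \<Psi>_hom: "\<Psi> i \<in> ring_hom rees_ring ring_of_type_algebra"
proof (rule ring_hom_memI)
  interpret A: cring rees_ring by (rule cring_rees_ring)
  fix p q assume pq: "p \<in> carrier rees_ring" "q \<in> carrier rees_ring"
  then have r: "p \<in> fiber.rees" "q \<in> fiber.rees" by simp_all
  note u = r[THEN reesD(1)]
  have "\<Psi>_poly i (p \<otimes>\<^bsub>rees_ring\<^esub> q) = \<Psi>_poly i p * \<Psi>_poly i q"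
  proof (rule poly_eqI)
    fix n
    have "coeff (\<Psi>_poly i (p \<otimes>\<^bsub>rees_ring\<^esub> q)) n = \<psi> i n (\<Sum>j\<le>n. p j * q (n - j))"
      using A.m_closed[OF pq] fiber.UP_mult[OF u] by (simp add: coeff_\<Psi>_poly type_ring_finsum)
    also have "\<dots> = (\<Sum>j\<le>n. \<psi> i (j + (n - j)) (p j * q (n - j)))" by (simp add: \<psi>_sum)
    also have "\<dots> = (\<Sum>j\<le>n. \<psi> i j (p j) * \<psi> i (n - j) (q (n - j)))"
      by (intro sum.cong refl \<psi>_mult reesD(2) r)
    finally show "coeff (\<Psi>_poly i (p \<otimes>\<^bsub>rees_ring\<^esub> q)) n = coeff (\<Psi>_poly i p * \<Psi>_poly i q) n"
      by (simp add: coeff_mult coeff_\<Psi>_poly r)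
  qed
  then show "\<Psi> i (p \<otimes>\<^bsub>rees_ring\<^esub> q) = \<Psi> i p \<otimes>\<^bsub>ring_of_type_algebra\<^esub> \<Psi> i q"
    by (simp add: \<Psi>_def)
  have "\<Psi>_poly i (p \<oplus>\<^bsub>rees_ring\<^esub> q) = \<Psi>_poly i p + \<Psi>_poly i q"
    using A.a_closed[OF pq] fiber.UP_add[OF u] r
    by (intro poly_eqI) (simp add: coeff_\<Psi>_poly \<psi>_add)
  then show "\<Psi> i (p \<oplus>\<^bsub>rees_ring\<^esub> q) = \<Psi> i p \<oplus>\<^bsub>ring_of_type_algebra\<^esub> \<Psi> i q"
    by (simp add: \<Psi>_def)
next
  interpret A: cring rees_ring by (rule cring_rees_ring)
  have "\<Psi>_poly i \<one>\<^bsub>rees_ring\<^esub> = 1"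
    using A.one_closed by (intro poly_eqI) (auto simp: coeff_\<Psi>_poly fiber.UP_one \<psi>_1)
  then show "\<Psi> i \<one>\<^bsub>rees_ring\<^esub> = \<one>\<^bsub>ring_of_type_algebra\<^esub>" by (simp add: \<Psi>_def)
qed simp

lemma \<Psi>_ker:
  assumes p: "p \<in> fiber.rees" and z: "fiber.proj p = \<zero>\<^bsub>fiber_cone mpoly_ring hom_max_ideal (mspan E)\<^esub>"
  shows "\<Psi> i p = 0"
proof -
  have "p n \<in> fiber.Qn n" for n
  proof -
    have "fiber.Qn n +>\<^bsub>mpoly_ring\<^esub> p n = fiber.Qn n"
      using fun_cong[OF z, of n] by (simp add: fiber.proj_def fiber_cone_def)
    moreover interpret Q: ideal "fiber.Qn n" "mpoly_ring :: ('x, 'k) mpoly ring" by (rule fiber.Q_ideal)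
    have "p n \<in> fiber.Qn n +>\<^bsub>mpoly_ring\<^esub> p n"
      using Q.a_rcos_self[of "p n"] by simp
    ultimately show ?thesis by simp
  qed
  then have "\<psi> i n (p n) = 0" for n
    by (intro \<psi>_eq_0) (simp add: ideal_pow_mspan hom_max_ideal_mspan ideal_prod_mspan)
  then have "\<Psi>_poly i p = 0" by (intro poly_eqI) (simp add: coeff_\<Psi>_poly p)
  then show ?thesis by (simp add: \<Psi>_def)
qed

text \<open>A larger \<open>i\<close> records more coordinates and gives a smaller prime; for
  \<open>i = 0\<close> every monomial of the face is sent to 1.\<close>

definition chain_prime :: "nat \<Rightarrow> (nat \<Rightarrow> ('x, 'k) mpoly set) set" where
  "chain_prime i = fiber.proj ` {p \<in> fiber.rees. \<Psi> i p = 0}"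

lemma chain_prime: "primeideal (chain_prime i) (fiber_cone mpoly_ring hom_max_ideal (mspan E))"
  and chain_prime_iff: "p \<in> fiber.rees \<Longrightarrow> fiber.proj p \<in> chain_prime i \<longleftrightarrow> \<Psi> i p = 0"
proof -
  have sur: "fiber.proj ` carrier rees_ring = carrier (fiber_cone mpoly_ring hom_max_ideal (mspan E))"
    using fiber.proj_surj by simp
  have ker: "\<Psi> i p = \<zero>\<^bsub>ring_of_type_algebra\<^esub>"
    if "p \<in> carrier rees_ring" "fiber.proj p = \<zero>\<^bsub>fiber_cone mpoly_ring hom_max_ideal (mspan E)\<^esub>" for p
    using \<Psi>_ker that by simp
  note * = primeideal_of_factor_hom[OF cring_rees_ring fiber.cring_fiber_cone domain_type_ring
      fiber.proj_hom sur \<Psi>_hom[of i] ker]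
  have eq: "chain_prime i = fiber.proj ` {p \<in> carrier rees_ring. \<Psi> i p = \<zero>\<^bsub>ring_of_type_algebra\<^esub>}"
    by (simp add: chain_prime_def)
  show "primeideal (chain_prime i) (fiber_cone mpoly_ring hom_max_ideal (mspan E))"
    unfolding eq by (rule *(1))
  show "fiber.proj p \<in> chain_prime i \<longleftrightarrow> \<Psi> i p = 0" if "p \<in> fiber.rees"
    unfolding eq using *(2)[of p] that by simp
qed

text \<open>Forgetting coordinate \<open>i\<close> of the exponents induces an additive map
  \<open>L\<close> that takes \<open>\<Psi> (Suc i) p\<close> to \<open>\<Psi> i p\<close>.\<close>

lemma \<Psi>_truncate:
  assumes p: "p \<in> fiber.rees" and z: "\<Psi> (Suc i) p = 0" shows "\<Psi> i p = 0"
proof -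
  define t :: "(nat \<Rightarrow>\<^sub>0 real) \<Rightarrow> (nat \<Rightarrow>\<^sub>0 real)"
    where "t v = (\<Sum>l<i. Poly_Mapping.single l (Poly_Mapping.lookup v l))" for v
  have t: "t (hvec (Suc i) u n) = hvec i u n" for u n
    unfolding t_def hvec_def[of i] by (intro sum.cong) (simp_all add: lookup_hvec)
  define L where "L = mlin (\<lambda>v (c :: 'k). Poly_Mapping.single (t v) c)"
  have Ls: "L (Poly_Mapping.single v c) = Poly_Mapping.single (t v) c" for v c
    unfolding L_def by (subst mlin_single) auto
  have Lsum: "L (sum g A) = (\<Sum>j\<in>A. L (g j))" for g and A :: "'z set"
    unfolding L_def by (rule mlin_sum) (auto simp: single_add)
  have L0: "L 0 = 0" by (simp add: L_def)
  have L\<psi>s: "L (\<psi> (Suc i) n (Poly_Mapping.single u c)) = \<psi> i n (Poly_Mapping.single u c)" for n u c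
    by (simp add: \<psi>_single Ls t L0)
  have L\<psi>: "L (\<psi> (Suc i) n f) = \<psi> i n f" for n f
    by (subst (1 2) poly_mapping_sum_single[of f, symmetric]) (simp only: \<psi>_sum Lsum L\<psi>s)
  obtain N where N: "\<And>n. n > N \<Longrightarrow> p n = 0" using reesD(3)[OF p] by blast
  have eq: "\<Psi> j p = (\<Sum>n\<le>N. \<psi> j n (p n))" for j by (rule \<Psi>_eq_sum[OF p N])
  have "\<Psi> i p = L (\<Psi> (Suc i) p)" unfolding eq Lsum L\<psi> ..
  then show ?thesis by (simp add: z L0)
qed

lemma chain_prime_strict: assumes "i < s" shows "chain_prime (Suc i) \<subset> chain_prime i"
proof
  show "chain_prime (Suc i) \<subseteq> chain_prime i" unfolding chain_prime_def using \<Psi>_truncate by blast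
  \<comment> \<open>This is X^e t - 1 with e = \<open>e i\<close>. In degree 1 the functionals
    before number \<open>i\<close> vanish at \<open>e i\<close> and number \<open>i\<close> is 1
    there, so the first \<open>i\<close> coordinates cannot tell X^e t from 1, but one more
    can.\<close>
  define p :: "nat \<Rightarrow> ('x, 'k) mpoly"
    where "p n = (if n = 0 then - 1 else if n = 1 then monomial (e i) else 0)" for n
  have "p n \<in> mspan (npow E n)" for n
    using e_in[OF assms] upset by (auto simp: p_def zero_in_mspan)
  moreover have "p \<in> up mpoly_ring"
    by (auto simp: up_def bound_def p_def intro!: exI[of _ 1])
  ultimately have p: "p \<in> fiber.rees" by (simp add: fiber.rees_def ideal_pow_mspan)
  have m1: "\<psi> j 0 (- 1) = - 1" for j
    using \<psi>_add[of j 0 1 "- 1"] by (simp add: \<psi>_1 add_eq_0_iff)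
  have \<Psi>p: "\<Psi> j p = Poly_Mapping.single (hvec j (e i) 1) 1 - 1" for j
  proof -
    have "\<Psi> j p = (\<Sum>n\<le>1. \<psi> j n (p n))"
      by (rule \<Psi>_eq_sum[OF p]) (simp add: p_def)
    also have "\<dots> = \<psi> j 1 (monomial (e i)) - 1"
      by (simp add: p_def m1)
    finally show ?thesis using \<delta>_e[OF assms] by (simp add: monomial_def \<psi>_single)
  qed
  have "hvec i (e i) 1 = 0"
    by (rule poly_mapping_eqI) (use assms h_e in \<open>auto simp: lookup_hvec\<close>)
  then have "\<Psi> i p = 0" by (simp add: \<Psi>p)
  then have "fiber.proj p \<in> chain_prime i" using chain_prime_iff[OF p] by simp
  moreover have "\<Psi> (Suc i) p \<noteq> 0"
  proof
    assume "\<Psi> (Suc i) p = 0"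
    then have "Poly_Mapping.keys (Poly_Mapping.single (hvec (Suc i) (e i) 1) (1::'k)) =
        Poly_Mapping.keys (1 :: (nat \<Rightarrow>\<^sub>0 real) \<Rightarrow>\<^sub>0 'k)"
      by (simp add: \<Psi>p)
    then have "hvec (Suc i) (e i) 1 = 0" by simp
    then have "Poly_Mapping.lookup (hvec (Suc i) (e i) 1) i = 0" by simp
    then show False using h_e[OF assms assms] by (simp add: lookup_hvec)
  qed
  then have "fiber.proj p \<notin> chain_prime (Suc i)" using chain_prime_iff[OF p] by simp
  ultimately show "chain_prime (Suc i) \<noteq> chain_prime i" by blast
qed

theorem analytic_spread_ge: "enat s \<le> analytic_spread (mspan E :: ('x, 'k) mpoly set)"
proof -
  \<comment> \<open>The index is reversed because \<open>chain_prime\<close> decreases while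
    \<open>krull_dim\<close> asks for increasing chains.\<close>
  have "\<forall>i\<le>s. primeideal (chain_prime (s - i)) (fiber_cone mpoly_ring hom_max_ideal (mspan E))"
    using chain_prime by blast
  moreover have "chain_prime (s - i) \<subset> chain_prime (s - Suc i)" if "i < s" for i
    using chain_prime_strict[of "s - Suc i"] that by (simp add: Suc_diff_Suc)
  ultimately have "\<exists>P. (\<forall>i\<le>s. primeideal (P i) (fiber_cone mpoly_ring hom_max_ideal (mspan E))) \<and>
      (\<forall>i<s. P i \<subset> (P (Suc i) :: (nat \<Rightarrow> ('x, 'k) mpoly set) set))"
    by (intro exI[of _ "\<lambda>i. chain_prime (s - i)"]) blast
  then show ?thesis
    unfolding analytic_spread_def krull_dim_def by (intro Sup_upper) blast
qed

end

section \<open>Sums of dilated polytopes\<close>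

definition polysum :: "'j set \<Rightarrow> ('j \<Rightarrow> 'a::real_vector set) \<Rightarrow> ('j \<Rightarrow> nat) \<Rightarrow> 'a set" where
  "polysum J G n = (\<Sum>j\<in>J. (\<lambda>y. real (n j) *\<^sub>R y) ` (convex hull (G j)))"

text \<open>The weights are not normalised: taking one unit off a generator then lowers n_j by 1
  without rescaling.\<close>

definition weighting :: "'j set \<Rightarrow> ('j \<Rightarrow> 'a::real_vector set) \<Rightarrow> ('j \<Rightarrow> nat) \<Rightarrow> 'a \<Rightarrow> ('j \<Rightarrow> 'a \<Rightarrow> real) \<Rightarrow> bool" where
  "weighting J G n x c \<longleftrightarrow> (\<forall>j\<in>J. (\<forall>g\<in>G j. 0 \<le> c j g) \<and> (\<Sum>g\<in>G j. c j g) = real (n j)) \<and>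
     (\<Sum>j\<in>J. \<Sum>g\<in>G j. c j g *\<^sub>R g) = x"

lemma polysum_iff:
  assumes J: "finite J" and G: "\<And>j. j \<in> J \<Longrightarrow> finite (G j)" "\<And>j. j \<in> J \<Longrightarrow> G j \<noteq> {}"
  shows "x \<in> polysum J G n \<longleftrightarrow> (\<exists>c. weighting J G n x c)"
proof
  assume "x \<in> polysum J G n"
  then obtain y where y: "x = sum y J"
      "\<forall>j\<in>J. y j \<in> (\<lambda>y. real (n j) *\<^sub>R y) ` (convex hull (G j))"
    unfolding polysum_def set_sum_alt[OF J] by blast
  have "\<forall>j\<in>J. \<exists>u. (\<forall>g\<in>G j. 0 \<le> u g) \<and> sum u (G j) = 1 \<and>
      y j = real (n j) *\<^sub>R (\<Sum>g\<in>G j. u g *\<^sub>R g)"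
    using y(2) by (force simp: convex_hull_finite[OF G(1)])
  then obtain u where u: "\<And>j g. j \<in> J \<Longrightarrow> g \<in> G j \<Longrightarrow> 0 \<le> u j g" "\<And>j. j \<in> J \<Longrightarrow> sum (u j) (G j) = 1"
      "\<And>j. j \<in> J \<Longrightarrow> y j = real (n j) *\<^sub>R (\<Sum>g\<in>G j. u j g *\<^sub>R g)"
    by metis
  have "weighting J G n x (\<lambda>j g. real (n j) * u j g)"
    unfolding weighting_def y(1) by (auto simp: u scaleR_sum_right simp flip: sum_distrib_left)
  then show "\<exists>c. weighting J G n x c" by (rule exI[of "weighting J G n x"])
next
  assume "\<exists>c. weighting J G n x c"
  then obtain c where c: "\<And>j g. j \<in> J \<Longrightarrow> g \<in> G j \<Longrightarrow> 0 \<le> c j g"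
      "\<And>j. j \<in> J \<Longrightarrow> (\<Sum>g\<in>G j. c j g) = real (n j)" "(\<Sum>j\<in>J. \<Sum>g\<in>G j. c j g *\<^sub>R g) = x"
    unfolding weighting_def by blast
  have "(\<Sum>g\<in>G j. c j g *\<^sub>R g) \<in> (\<lambda>y. real (n j) *\<^sub>R y) ` (convex hull (G j))" if j: "j \<in> J" for j
  proof (cases "n j = 0")
    \<comment> \<open>Nothing can be divided by n_j here: all weights vanish, and the dilated hull
      is {0} because \<open>G j\<close> is nonempty.\<close>
    case True
    then have "\<forall>g\<in>G j. c j g = 0" using c(1,2)[OF j] G(1)[OF j] by (simp add: sum_nonneg_eq_0_iff)
    then have "(\<Sum>g\<in>G j. c j g *\<^sub>R g) = 0" by simp
    moreover have "convex hull (G j) \<noteq> {}" using G(2)[OF j] by simp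
    ultimately show ?thesis using True by (simp add: image_constant_conv)
  next
    case False
    have "(\<Sum>g\<in>G j. c j g / real (n j)) = 1"
      using False c(2)[OF j] by (simp flip: sum_divide_distrib)
    then have "(\<Sum>g\<in>G j. (c j g / real (n j)) *\<^sub>R g) \<in> convex hull (G j)"
      using c(1)[OF j] G(1)[OF j] by (intro convex_sum) (auto intro: hull_inc)
    moreover have "real (n j) *\<^sub>R (\<Sum>g\<in>G j. (c j g / real (n j)) *\<^sub>R g) = (\<Sum>g\<in>G j. c j g *\<^sub>R g)"
      using False by (simp add: scaleR_sum_right)
    ultimately show ?thesis
      by (intro image_eqI[of _ _ "\<Sum>g\<in>G j. (c j g / real (n j)) *\<^sub>R g"]) simp_all
  qed
  then show "x \<in> polysum J G n"
    unfolding polysum_def set_sum_alt[OF J] using c(3)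
    by (auto intro!: exI[of _ "\<lambda>j. \<Sum>g\<in>G j. c j g *\<^sub>R g"])
qed

lemma polytope_polysum:
  assumes "finite J" "\<And>j. j \<in> J \<Longrightarrow> finite (G j)"
  shows "polytope (polysum J G n)"
proof -
  have "polysum J G n = (\<Sum>j\<in>J. convex hull ((\<lambda>y. real (n j) *\<^sub>R y) ` G j))"
    unfolding polysum_def by (intro sum.cong refl convex_hull_scaling[symmetric])
  also have "\<dots> = convex hull (\<Sum>j\<in>J. (\<lambda>y. real (n j) *\<^sub>R y) ` G j)"
    by (rule convex_hull_set_sum[symmetric])
  finally have "polysum J G n = convex hull (\<Sum>j\<in>J. (\<lambda>y. real (n j) *\<^sub>R y) ` G j)" .
  moreover have "finite (\<Sum>j\<in>J. (\<lambda>y. real (n j) *\<^sub>R y) ` G j)"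
    using assms by (induction J rule: finite_induct) (auto simp: finite_set_plus)
  ultimately show ?thesis unfolding polytope_def by blast
qed

section \<open>Minimal points of a polytope and positive functionals\<close>

lemma exists_minimal_below:
  fixes D :: "(real^'x::finite) set"
  assumes "compact D" "d \<in> D" "d \<le> u"
  obtains v where "v \<in> D" "v \<le> u" "\<And>y. y \<in> D \<Longrightarrow> y \<le> v \<Longrightarrow> y = v"
proof -
  \<comment> \<open>A minimiser of the coordinate sum over the compact set of points below
    \<open>u\<close> is minimal componentwise, since any other point of \<open>D\<close> below it
    would have a smaller sum.\<close>
  let ?f = "\<lambda>y :: real^'x. \<Sum>i\<in>UNIV. y $ i"
  have 1: "compact (D \<inter> {..u})" using assms by (intro compact_Int_closed closed_eucl_atMost)
  have 2: "continuous_on (D \<inter> {..u}) ?f" by (intro continuous_intros)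
  have 3: "D \<inter> {..u} \<noteq> {}" using assms by auto
  obtain v where v: "v \<in> D \<inter> {..u}" "\<And>y. y \<in> D \<inter> {..u} \<Longrightarrow> ?f v \<le> ?f y"
    using bexE[OF continuous_attains_inf[OF 1 3 2]] by metis
  have "y = v" if y: "y \<in> D" "y \<le> v" for y
  proof (rule ccontr)
    assume "y \<noteq> v"
    then obtain i where "y $ i \<noteq> v $ i" by (auto simp: vec_eq_iff)
    with y have "?f y < ?f v"
      by (intro sum_strict_mono_ex1) (auto simp: less_eq_vec_def order.strict_iff_order)
    moreover have "y \<in> D \<inter> {..u}" using y v by auto
    ultimately show False using v(2)[of y] by simp
  qed
  with v that show thesis by blast
qed

text \<open>The closed cone spanned by the polytope seen from \<open>v\<close> and the positive orthant misses the
  compact set \<open>N\<close> of negated probability vectors, and a separating functional has the required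
  signs.\<close>

lemma minimal_imp_positive_functional:
  fixes D :: "(real^'x::finite) set"
  assumes D: "polytope D" and v: "v \<in> D" "\<And>y. y \<in> D \<Longrightarrow> y \<le> v \<Longrightarrow> y = v"
  obtains w :: "real^'x" where "\<And>i. 0 < w $ i" "\<And>d. d \<in> D \<Longrightarrow> w \<bullet> v \<le> w \<bullet> d"
proof -
  obtain H where H: "finite H" "D = convex hull H" using D by (auto simp: polytope_def)
  define S where "S = (\<lambda>h. h - v) ` H \<union> range (\<lambda>i. axis i (1::real))"
  let ?C = "convex_cone hull S"
  \<comment> \<open>An explicit cone containing the hull \<open>?C\<close>; it lets a point of
    \<open>D\<close> be read off from a point of \<open>?C\<close>.\<close>
  let ?K = "{t *\<^sub>R (d - v) + p | t d p. 0 \<le> t \<and> d \<in> D \<and> 0 \<le> p}"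
  define N where "N = (\<lambda>x::real^'x. - x) ` (convex hull (range (\<lambda>i. axis i 1)))"
  have fin: "finite (range (\<lambda>i. axis i (1::real)) :: (real^'x) set)" by simp
  have "convex D" using H by simp
  have "convex_cone ?K"
    unfolding convex_cone_iff
  proof (intro conjI ballI allI impI)
    show "0 \<in> ?K" using v(1)
      by (intro CollectI exI[of _ "0::real"] exI[of _ v] exI[of _ "0::real^'x"]) auto
  next
    fix x y assume "x \<in> ?K" "y \<in> ?K"
    then obtain t d p t' d' p' where *: "x = t *\<^sub>R (d - v) + p" "y = t' *\<^sub>R (d' - v) + p'"
        "0 \<le> t" "0 \<le> t'" "d \<in> D" "d' \<in> D" "0 \<le> p" "0 \<le> p'" by blast
    show "x + y \<in> ?K"
    proof (cases "t + t' = 0")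
      case True
      then have "t = 0" "t' = 0" using *(3,4) by auto
      then have "x + y = 0 *\<^sub>R (d - v) + (p + p')" using *(1,2) by simp
      then show ?thesis using *(5,7,8)
        by (intro CollectI exI[of _ "0::real"] exI[of _ d] exI[of _ "p + p'"]) (auto intro: add_nonneg_nonneg)
    next
      case False
      then have pos: "t + t' > 0" using *(3,4) by simp
      define d'' where "d'' = (t / (t + t')) *\<^sub>R d + (t' / (t + t')) *\<^sub>R d'"
      have "t / (t + t') + t' / (t + t') = 1" using pos by (simp flip: add_divide_distrib)
      then have "d'' \<in> D" unfolding d''_def using *(3-6) pos by (intro convexD[OF \<open>convex D\<close>]) auto
      moreover have "(t + t') *\<^sub>R d'' = t *\<^sub>R d + t' *\<^sub>R d'"
        unfolding d''_def using pos by (simp add: scaleR_add_right)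
      then have "x + y = (t + t') *\<^sub>R (d'' - v) + (p + p')"
        unfolding * by (simp add: scaleR_diff_right scaleR_add_left)
      ultimately show ?thesis using *(7,8) pos
        by (intro CollectI exI[of _ "t + t'"] exI[of _ d''] exI[of _ "p + p'"]) (auto intro: add_nonneg_nonneg)
    qed
  next
    fix x and c :: real assume "x \<in> ?K" "0 \<le> c"
    then obtain t d p where "x = t *\<^sub>R (d - v) + p" "0 \<le> t" "d \<in> D" "0 \<le> p" by blast
    then show "c *\<^sub>R x \<in> ?K" using \<open>0 \<le> c\<close>
      by (intro CollectI exI[of _ "c * t"] exI[of _ d] exI[of _ "c *\<^sub>R p"])
         (auto simp: scaleR_add_right intro: scaleR_nonneg_nonneg)
  qed
  moreover have "S \<subseteq> ?K"
  proof
    fix s assume "s \<in> S"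
    then consider h where "h \<in> H" "s = h - v" | i where "s = axis i 1" unfolding S_def by auto
    then show "s \<in> ?K"
    proof cases
      case 1
      then show ?thesis using H hull_subset[of H convex]
        by (intro CollectI exI[of _ "1::real"] exI[of _ h] exI[of _ "0::real^'x"]) auto
    next
      case 2
      then show ?thesis using v(1)
        by (intro CollectI exI[of _ "0::real"] exI[of _ v] exI[of _ "axis i 1"])
           (auto simp: less_eq_vec_def axis_def)
    qed
  qed
  ultimately have CK: "?C \<subseteq> ?K" by (simp add: hull_minimal)
  have N: "\<exists>x. z = - x \<and> 0 \<le> x \<and> x \<noteq> 0" if "z \<in> N" for z
  proof -
    obtain x where x: "z = - x" "x \<in> convex hull (range (\<lambda>i. axis i 1))" using \<open>z \<in> N\<close> N_def by blast
    have "convex {x :: real^'x. 0 \<le> x \<and> (\<Sum>i\<in>UNIV. x $ i) = 1}"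
      by (auto simp: convex_alt less_eq_vec_def sum.distrib simp flip: sum_distrib_left)
    moreover have "axis i 1 \<in> {x :: real^'x. 0 \<le> x \<and> (\<Sum>i\<in>UNIV. x $ i) = 1}" for i
      by (auto simp: less_eq_vec_def axis_def)
    ultimately have "convex hull (range (\<lambda>i. axis i 1)) \<subseteq> {x :: real^'x. 0 \<le> x \<and> (\<Sum>i\<in>UNIV. x $ i) = 1}"
      by (intro hull_minimal) auto
    with x show ?thesis by force
  qed
  \<comment> \<open>A common point gives t (d - v) = -(x + p) with x nonnegative and nonzero. Then t
    > 0 and d <= v, so minimality forces d = v and hence x = 0.\<close>
  have disj: "?C \<inter> N = {}"
  proof (rule ccontr)
    assume "?C \<inter> N \<noteq> {}"
    then obtain z where "z \<in> ?K" "z \<in> N" using CK by blast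
    then obtain t d p x where *: "t *\<^sub>R (d - v) + p = - x" "0 \<le> t" "d \<in> D" "0 \<le> p" "0 \<le> x" "x \<noteq> 0"
      using N by force
    have neg: "t *\<^sub>R (d - v) = - (x + p)" using * by (simp add: algebra_simps eq_neg_iff_add_eq_0)
    have "0 < t"
    proof (rule ccontr)
      assume "\<not> 0 < t"
      then have "x + p = 0" using * neg by simp
      then show False using * by (metis add_nonneg_eq_0_iff)
    qed
    have "d - v = (1 / t) *\<^sub>R (t *\<^sub>R (d - v))" using \<open>0 < t\<close> by simp
    also have "\<dots> = - ((1 / t) *\<^sub>R (x + p))" unfolding neg by (simp only: scaleR_minus_right)
    finally have "d - v = - ((1 / t) *\<^sub>R (x + p))" .
    moreover have "0 \<le> (1 / t) *\<^sub>R (x + p)" using * \<open>0 < t\<close> by (intro scaleR_nonneg_nonneg) auto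
    ultimately have "d \<le> v" by (metis diff_le_0_iff_le neg_le_0_iff_le)
    then have "d = v" using v(2) * by blast
    then have "- (x + p) = 0" using neg by (simp only: diff_self scaleR_zero_right)
    then have "x + p = 0" by (simp only: neg_equal_0_iff_equal)
    then show False using *(4-6) by (metis add_nonneg_eq_0_iff)
  qed
  have "compact N" "convex N" "N \<noteq> {}"
    unfolding N_def using finite_imp_compact_convex_hull[OF fin]
    by (simp_all add: compact_negations convex_negations)
  \<comment> \<open>Closedness rests on finite generation, that is on \<open>D\<close> being a
    polytope. It gives strict separation and thus strictly positive coordinates.\<close>
  moreover have "closed ?C" using H fin by (intro closed_convex_cone_hull) (auto simp: S_def)
  ultimately obtain a b where ab: "\<And>x. x \<in> ?C \<Longrightarrow> a \<bullet> x < b" "\<And>x. x \<in> N \<Longrightarrow> b < a \<bullet> x"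
    using separating_hyperplane_closed_compact[of ?C N] disj convex_convex_cone_hull[of S] by blast
  have "0 < b" using ab(1)[of 0] by (simp add: convex_cone_hull_contains_0)
  have C: "a \<bullet> x \<le> 0" if "x \<in> ?C" for x
  proof (rule ccontr)
    assume "\<not> a \<bullet> x \<le> 0"
    \<comment> \<open>A functional bounded above on a cone is nonpositive there: this multiple would
      reach the excluded value \<open>b\<close>.\<close>
    then have "(b / (a \<bullet> x)) *\<^sub>R x \<in> ?C" using that \<open>0 < b\<close> by (intro convex_cone_hull_mul) simp_all
    from ab(1)[OF this] show False using \<open>\<not> a \<bullet> x \<le> 0\<close> by simp
  qed
  show thesis
  proof (rule that[of "- a"])
    fix i :: 'x
    have "axis i 1 \<in> convex hull (range (\<lambda>i. axis i (1::real)))" by (intro hull_inc) simp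
    then have "- axis i 1 \<in> N" unfolding N_def by blast
    from ab(2)[OF this] \<open>0 < b\<close> show "0 < (- a) $ i" by (simp add: inner_axis)
  next
    fix d assume "d \<in> D"
    moreover have "H \<subseteq> {x. - a \<bullet> v \<le> - a \<bullet> x}"
    proof
      fix h assume "h \<in> H"
      then have "h - v \<in> ?C" by (intro hull_inc) (auto simp: S_def)
      from C[OF this] show "h \<in> {x. - a \<bullet> v \<le> - a \<bullet> x}" by (simp add: inner_diff_right)
    qed
    then have "D \<subseteq> {x. - a \<bullet> v \<le> - a \<bullet> x}" unfolding H(2)
      by (intro hull_minimal) (simp_all add: convex_halfspace_ge del: inner_minus_left)
    ultimately show "- a \<bullet> v \<le> - a \<bullet> d" by blast
  qed
qed

section \<open>Weightings of minimal support\<close>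

definition supp :: "'j set \<Rightarrow> ('j \<Rightarrow> 'a set) \<Rightarrow> ('j \<Rightarrow> 'a \<Rightarrow> real) \<Rightarrow> ('j \<times> 'a) set" where
  "supp J G c = {(j, g). j \<in> J \<and> g \<in> G j \<and> 0 < c j g}"

lemma finite_supp: "finite J \<Longrightarrow> (\<And>j. j \<in> J \<Longrightarrow> finite (G j)) \<Longrightarrow> finite (supp J G c)"
  by (rule finite_subset[of _ "Sigma J G"]) (auto simp: supp_def)

text \<open>Caratheodory's reduction: adding a multiple of a nonzero relation \<open>d\<close> on
  the support changes neither the totals nor the point, and the multiple can be chosen so that a
  weight reaches zero and the support shrinks.\<close>

lemma minimal_support:
  assumes J: "finite J" and G: "\<And>j. j \<in> J \<Longrightarrow> finite (G j)" and c0: "weighting J G n x c0"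
  shows "\<exists>c. weighting J G n x c \<and>
    (\<forall>d. (\<forall>j g. (j, g) \<notin> supp J G c \<longrightarrow> d j g = 0) \<longrightarrow> (\<forall>j\<in>J. (\<Sum>g\<in>G j. d j g) = 0) \<longrightarrow>
        (\<Sum>j\<in>J. \<Sum>g\<in>G j. d j g *\<^sub>R g) = 0 \<longrightarrow> d = (\<lambda>_ _. 0 :: real))"
proof -
  define c where "c = arg_min (\<lambda>c. card (supp J G c)) (weighting J G n x)"
  have c: "weighting J G n x c" unfolding c_def by (rule arg_min_natI[of "weighting J G n x", OF c0])
  have min: "card (supp J G c) \<le> card (supp J G c')" if "weighting J G n x c'" for c'
    unfolding c_def by (rule arg_min_nat_le[of "weighting J G n x", OF that])
  have "d = (\<lambda>_ _. 0)"
    if d: "\<And>j g. (j, g) \<notin> supp J G c \<Longrightarrow> d j g = 0" "\<And>j. j \<in> J \<Longrightarrow> (\<Sum>g\<in>G j. d j g) = 0"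
      "(\<Sum>j\<in>J. \<Sum>g\<in>G j. d j g *\<^sub>R g) = 0" for d
  proof (rule ccontr)
    assume "d \<noteq> (\<lambda>_ _. 0)"
    then obtain j g where jg: "d j g \<noteq> 0" by (auto simp: fun_eq_iff)
    then have jgs: "(j, g) \<in> supp J G c" using d(1) by blast
    then have j: "j \<in> J" "g \<in> G j" by (auto simp: supp_def)
    \<comment> \<open>The entries over \<open>G j\<close> sum to zero and one is nonzero, so one is
      negative; moving along \<open>d\<close> must therefore meet zero.\<close>
    have "\<exists>g\<in>G j. d j g < 0"
    proof (rule ccontr)
      assume "\<not> ?thesis"
      then have "\<forall>g\<in>G j. d j g = 0"
        using d(2)[OF j(1)] G[OF j(1)] by (subst (asm) sum_nonneg_eq_0_iff) (auto simp: not_less)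
      then show False using jg j by blast
    qed
    then obtain g1 where g1: "g1 \<in> G j" "d j g1 < 0" by blast
    define A where "A = {(j, g) \<in> supp J G c. d j g < 0}"
    have "finite A" unfolding A_def by (rule finite_subset[of _ "supp J G c"]) (auto intro: finite_supp J G)
    moreover have "(j, g1) \<in> A" unfolding A_def using g1 d(1)[of j g1] by force
    ultimately obtain p where "is_arg_min (\<lambda>(j, g). c j g / - d j g) (\<lambda>p. p \<in> A) p"
      using ex_is_arg_min_if_finite[of A] by blast
    then obtain j0 g0 where m: "(j0, g0) \<in> A"
        "\<And>j g. (j, g) \<in> A \<Longrightarrow> c j0 g0 / - d j0 g0 \<le> c j g / - d j g"
      unfolding is_arg_min_linorder by (cases p) fastforce
    \<comment> \<open>The ratio test: the largest step along \<open>d\<close> that keeps all weights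
      nonnegative. It cancels the weight at \<open>(j0, g0)\<close>.\<close>
    define t where "t = c j0 g0 / - d j0 g0"
    have m0: "d j0 g0 < 0" "c j0 g0 > 0" "j0 \<in> J" "g0 \<in> G j0"
      using m(1) by (auto simp: A_def supp_def)
    have t: "0 < t" "c j0 g0 + t * d j0 g0 = 0" using m0 by (auto simp: t_def divide_neg_neg field_simps)
    define c' where "c' j g = c j g + t * d j g" for j g
    have c'0: "0 \<le> c' j g" if "j \<in> J" "g \<in> G j" for j g
    proof (cases "(j, g) \<in> A")
      case True
      then have "0 < - d j g" by (auto simp: A_def)
      moreover have "t \<le> c j g / - d j g" using m(2)[OF True] by (simp only: t_def)
      ultimately have "t * - d j g \<le> c j g" by (simp only: pos_le_divide_eq)
      then show ?thesis by (simp add: c'_def)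
    next
      case False
      have "0 \<le> c j g" using c that by (auto simp: weighting_def)
      moreover have "0 \<le> d j g" using False d(1)[of j g] by (cases "(j, g) \<in> supp J G c") (auto simp: A_def)
      ultimately show ?thesis using t by (simp add: c'_def)
    qed
    have "weighting J G n x c'"
      unfolding weighting_def
    proof (intro conjI ballI c'0)
      fix j assume "j \<in> J"
      then show "(\<Sum>g\<in>G j. c' j g) = real (n j)" using c d(2)[of j]
        by (simp add: c'_def weighting_def sum.distrib flip: sum_distrib_left)
    next
      have "(\<Sum>j\<in>J. \<Sum>g\<in>G j. c' j g *\<^sub>R g) =
          (\<Sum>j\<in>J. \<Sum>g\<in>G j. c j g *\<^sub>R g) + t *\<^sub>R (\<Sum>j\<in>J. \<Sum>g\<in>G j. d j g *\<^sub>R g)"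
        by (simp add: c'_def scaleR_add_left sum.distrib scaleR_sum_right)
      then show "(\<Sum>j\<in>J. \<Sum>g\<in>G j. c' j g *\<^sub>R g) = x" using c d(3) by (simp add: weighting_def)
    qed
    moreover have "supp J G c' \<subset> supp J G c"
    proof
      show "supp J G c' \<subseteq> supp J G c"
      proof (clarify, rule ccontr)
        fix j g assume "(j, g) \<in> supp J G c'" "(j, g) \<notin> supp J G c"
        then show False using d(1)[of j g] by (auto simp: supp_def c'_def)
      qed
      have "(j0, g0) \<in> supp J G c" "(j0, g0) \<notin> supp J G c'"
        using m0 t by (auto simp: supp_def c'_def)
      then show "supp J G c' \<noteq> supp J G c" by blast
    qed
    then have "card (supp J G c') < card (supp J G c)"
      by (intro psubset_card_mono finite_supp J G)
    ultimately show False using min by fastforce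
  qed
  with c show ?thesis by blast
qed

text \<open>An exchange argument: moving the whole weight of \<open>g\<close> to \<open>g'\<close>
  stays in the polytope and shifts the point by c j g (g' - g), along which \<open>w\<close> must
  not decrease.\<close>

lemma weighting_optimal_supp:
  fixes w :: "'a::euclidean_space"
  assumes J: "finite J" and G: "\<And>j. j \<in> J \<Longrightarrow> finite (G j)" "\<And>j. j \<in> J \<Longrightarrow> G j \<noteq> {}"
    and c: "weighting J G n v c" and w: "\<And>y. y \<in> polysum J G n \<Longrightarrow> w \<bullet> v \<le> w \<bullet> y"
    and jg: "(j, g) \<in> supp J G c" and g': "g' \<in> G j"
  shows "w \<bullet> g \<le> w \<bullet> g'"
proof (rule ccontr)
  assume neg: "\<not> ?thesis"
  have j: "j \<in> J" "g \<in> G j" "0 < c j g" using jg by (auto simp: supp_def)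
  have ne: "g \<noteq> g'" using neg by auto
  define c' where "c' = c(j := (c j)(g := 0, g' := c j g' + c j g))"
  \<comment> \<open>Stated for arbitrary \<open>f\<close> to serve twice: the constant 1 gives the
    total weight, the identity gives the point.\<close>
  have sm: "(\<Sum>h\<in>G j. c' j h *\<^sub>R f h) = (\<Sum>h\<in>G j. c j h *\<^sub>R f h) + c j g *\<^sub>R (f g' - f g)"
    for f :: "'a \<Rightarrow> 'z::real_vector"
  proof -
    have "(\<Sum>h\<in>G j. c' j h *\<^sub>R f h) - (\<Sum>h\<in>G j. c j h *\<^sub>R f h) =
        (\<Sum>h\<in>G j. (if h = g' then c j g *\<^sub>R f g' else 0) - (if h = g then c j g *\<^sub>R f g else 0))"
      unfolding sum_subtractf[symmetric] using ne by (intro sum.cong) (auto simp: c'_def algebra_simps)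
    also have "\<dots> = c j g *\<^sub>R f g' - c j g *\<^sub>R f g"
      using G(1)[OF j(1)] g' j(2) by (simp add: sum_subtractf)
    finally show ?thesis by (simp add: algebra_simps)
  qed
  let ?y = "v + c j g *\<^sub>R (g' - g)"
  have "weighting J G n ?y c'"
    unfolding weighting_def
  proof (intro conjI ballI)
    fix i h assume "i \<in> J" "h \<in> G i"
    then show "0 \<le> c' i h" using c j g' by (auto simp: c'_def weighting_def add_nonneg_nonneg)
  next
    fix i assume "i \<in> J"
    then show "(\<Sum>h\<in>G i. c' i h) = real (n i)"
      using sm[of "\<lambda>_. 1 :: real"] c by (cases "i = j") (auto simp: weighting_def c'_def)
  next
    have "(\<Sum>i\<in>J. \<Sum>h\<in>G i. c' i h *\<^sub>R h) = (\<Sum>h\<in>G j. c' j h *\<^sub>R h) + (\<Sum>i\<in>J - {j}. \<Sum>h\<in>G i. c' i h *\<^sub>R h)"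
      by (rule sum.remove[OF J j(1)])
    also have "(\<Sum>i\<in>J - {j}. \<Sum>h\<in>G i. c' i h *\<^sub>R h) = (\<Sum>i\<in>J - {j}. \<Sum>h\<in>G i. c i h *\<^sub>R h)"
      by (intro sum.cong refl) (auto simp: c'_def)
    finally show "(\<Sum>i\<in>J. \<Sum>h\<in>G i. c' i h *\<^sub>R h) = ?y"
      using c sum.remove[OF J j(1), of "\<lambda>i. \<Sum>h\<in>G i. c i h *\<^sub>R h"]
      by (simp add: sm[of "\<lambda>h. h"] weighting_def)
  qed
  then have "?y \<in> polysum J G n" using polysum_iff[of J G, OF J G] by blast
  from w[OF this] have "0 \<le> c j g * (w \<bullet> g' - w \<bullet> g)" by (simp add: inner_add_right inner_diff_right)
  then show False using neg j(3) by (simp add: zero_le_mult_iff)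
qed

text \<open>Weights below 1 with total n_j > 0 are strictly more than n_j in number; by integrality
  this is at least one extra generator for each such index.\<close>

lemma card_supp_ge:
  assumes J: "finite J" and G: "\<And>j. j \<in> J \<Longrightarrow> finite (G j)" and c: "weighting J G n v c"
    and lt: "\<And>j g. (j, g) \<in> supp J G c \<Longrightarrow> c j g < 1"
  shows "(\<Sum>j\<in>J. n j) + card {j\<in>J. 0 < n j} \<le> card (supp J G c)"
proof -
  have "n j + (if 0 < n j then 1 else 0) \<le> card {g\<in>G j. 0 < c j g}" if j: "j \<in> J" for j
  proof (cases "n j = 0")
    case False
    let ?S = "{g\<in>G j. 0 < c j g}"
    have fin: "finite ?S" using G[OF j] by simp
    have "(\<Sum>g\<in>G j. c j g) = (\<Sum>g\<in>?S. c j g)"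
      using c j G[OF j] by (intro sum.mono_neutral_right) (force simp: weighting_def)+
    then have nj: "real (n j) = (\<Sum>g\<in>?S. c j g)" using c j by (simp add: weighting_def)
    then have "?S \<noteq> {}" using False by (metis of_nat_eq_0_iff sum.empty)
    then have "(\<Sum>g\<in>?S. c j g) < (\<Sum>g\<in>?S. 1)"
      using fin lt j by (intro sum_strict_mono) (auto simp: supp_def)
    then show ?thesis using nj by simp
  qed simp
  then have "(\<Sum>j\<in>J. n j + (if 0 < n j then 1 else 0)) \<le> (\<Sum>j\<in>J. card {g\<in>G j. 0 < c j g})"
    by (intro sum_mono) blast
  moreover have "supp J G c = Sigma J (\<lambda>j. {g\<in>G j. 0 < c j g})" by (auto simp: supp_def)
  then have "card (supp J G c) = (\<Sum>j\<in>J. card {g\<in>G j. 0 < c j g})" using J G by simp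
  moreover have "(\<Sum>j\<in>J. if 0 < n j then 1 else 0) = card {j\<in>J. 0 < n j}"
    using J by (simp add: sum.If_cases Int_def)
  ultimately show ?thesis by (simp add: sum.distrib)
qed

text \<open>The first outcome feeds the induction on |n|, the second bounds the analytic spread. The
  last condition on \<open>B\<close> is linear independence of a family indexed by pairs, so it also
  forbids equal differences over distinct indices.\<close>

lemma large_weight_or_large_face:
  fixes G :: "'j \<Rightarrow> (real^'x::finite) set"
  assumes J: "finite J" and G: "\<And>j. j \<in> J \<Longrightarrow> finite (G j)" "\<And>j. j \<in> J \<Longrightarrow> G j \<noteq> {}"
    and u: "d \<in> polysum J G n" "d \<le> u"
  obtains
    (weight) v c j g where "weighting J G n v c" "v \<le> u" "j \<in> J" "g \<in> G j" "1 \<le> c j g"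
  | (face) w :: "real^'x" and b B where "\<And>i. 0 < w $ i"
      "\<And>j. j \<in> J \<Longrightarrow> b j \<in> G j" "\<And>j g. j \<in> J \<Longrightarrow> g \<in> G j \<Longrightarrow> w \<bullet> b j \<le> w \<bullet> g"
      "B \<subseteq> Sigma J G" "\<And>j g. (j, g) \<in> B \<Longrightarrow> w \<bullet> g = w \<bullet> b j"
      "(\<Sum>j\<in>J. n j) \<le> card B"
      "\<And>d. (\<Sum>(j, g)\<in>B. d (j, g) *\<^sub>R (g - b j)) = 0 \<Longrightarrow> \<forall>p\<in>B. d p = (0 :: real)"
proof -
  have D: "polytope (polysum J G n)" using J G by (intro polytope_polysum)
  obtain v where v: "v \<in> polysum J G n" "v \<le> u" "\<And>y. y \<in> polysum J G n \<Longrightarrow> y \<le> v \<Longrightarrow> y = v"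
    using exists_minimal_below[OF polytope_imp_compact[OF D] u] by metis
  obtain w :: "real^'x" where w: "\<And>i. 0 < w $ i" "\<And>y. y \<in> polysum J G n \<Longrightarrow> w \<bullet> v \<le> w \<bullet> y"
    using minimal_imp_positive_functional[OF D v(1,3)] by metis
  obtain c0 where c0: "weighting J G n v c0" using polysum_iff[of J G, OF J G] v(1) by blast
  have "\<exists>c. weighting J G n v c \<and> (\<forall>d. (\<forall>j g. (j, g) \<notin> supp J G c \<longrightarrow> d j g = 0) \<longrightarrow> (\<forall>j\<in>J. (\<Sum>g\<in>G j. d j g) = 0) \<longrightarrow>
        (\<Sum>j\<in>J. \<Sum>g\<in>G j. d j g *\<^sub>R g) = 0 \<longrightarrow> d = (\<lambda>_ _. 0 :: real))"
    using J G(1) c0 by (rule minimal_support)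
  then obtain c where c1: "weighting J G n v c" and c2: "\<forall>d. (\<forall>j g. (j, g) \<notin> supp J G c \<longrightarrow> d j g = 0) \<longrightarrow> (\<forall>j\<in>J. (\<Sum>g\<in>G j. d j g) = 0) \<longrightarrow>
        (\<Sum>j\<in>J. \<Sum>g\<in>G j. d j g *\<^sub>R g) = 0 \<longrightarrow> d = (\<lambda>_ _. 0 :: real)"
    by blast
  note c = c1 c2[rule_format]
  show thesis
  proof (cases "\<exists>j g. (j, g) \<in> supp J G c \<and> 1 \<le> c j g")
    case True
    then obtain j g where "(j, g) \<in> supp J G c" "1 \<le> c j g" by blast
    then show thesis using weight[OF c(1) v(2)] by (auto simp: supp_def)
  next
    case False
    then have lt: "\<And>j g. (j, g) \<in> supp J G c \<Longrightarrow> c j g < 1" by force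
    define A where "A = supp J G c"
    have finA: "finite A" unfolding A_def using J G(1) by (rule finite_supp)
    \<comment> \<open>The base points. They minimise \<open>w\<close> on each \<open>G j\<close> and
      come from the support whenever n_j > 0, so that dropping them removes exactly one pair for
      each such index.\<close>
    have "\<exists>g\<in>G j. (\<forall>g'\<in>G j. w \<bullet> g \<le> w \<bullet> g') \<and> (0 < n j \<longrightarrow> (j, g) \<in> A)" if j: "j \<in> J" for j
    proof (cases "\<exists>g. (j, g) \<in> A")
      case True
      then obtain g where "(j, g) \<in> A" ..
      then show ?thesis using weighting_optimal_supp[of J G, OF J G c(1) w(2)] unfolding A_def
        by (intro bexI[of _ g]) (auto simp: supp_def)
    next
      case none: False
      obtain g where "is_arg_min (\<lambda>g. w \<bullet> g) (\<lambda>g. g \<in> G j) g"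
        using ex_is_arg_min_if_finite[OF G(1)[OF j] G(2)[OF j]] by blast
      moreover have "c j g = 0" if "g \<in> G j" for g
        using none that j c(1) by (force simp: A_def supp_def weighting_def)
      then have "(\<Sum>g\<in>G j. c j g) = 0" by (intro sum.neutral) blast
      then have "n j = 0" using c1 j by (simp add: weighting_def)
      ultimately show ?thesis unfolding is_arg_min_linorder by auto
    qed
    then obtain b where b: "\<And>j. j \<in> J \<Longrightarrow> b j \<in> G j"
        "\<And>j g. j \<in> J \<Longrightarrow> g \<in> G j \<Longrightarrow> w \<bullet> b j \<le> w \<bullet> g" "\<And>j. j \<in> J \<Longrightarrow> 0 < n j \<Longrightarrow> (j, b j) \<in> A"
      by metis
    define B where "B = A - (\<lambda>j. (j, b j)) ` {j\<in>J. 0 < n j}"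
    have AJ: "j \<in> J" "g \<in> G j" "0 < n j" if "(j, g) \<in> A" for j g
    proof -
      show j: "j \<in> J" "g \<in> G j" using that by (auto simp: A_def supp_def)
      show "0 < n j"
      proof (rule ccontr)
        assume "\<not> 0 < n j"
        then have "(\<Sum>g\<in>G j. c j g) = 0" using c(1) j by (simp add: weighting_def)
        then have "c j g = 0" using c(1) j G(1)[OF j(1)] by (subst (asm) sum_nonneg_eq_0_iff) (auto simp: weighting_def)
        then show False using that by (simp add: A_def supp_def)
      qed
    qed
    have sub: "(\<lambda>j. (j, b j)) ` {j\<in>J. 0 < n j} \<subseteq> A" using b(3) by auto
    have "card B = card A - card {j\<in>J. 0 < n j}"
      unfolding B_def using finA sub J by (subst card_Diff_subset) (auto simp: card_image inj_on_def)
    then have card: "(\<Sum>j\<in>J. n j) \<le> card B"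
      using card_supp_ge[of J G n v c, OF J G(1) c(1) lt] unfolding A_def by simp
    have B: "(j, g) \<in> B \<longleftrightarrow> (j, g) \<in> A \<and> g \<noteq> b j" for j g using AJ by (auto simp: B_def)
    have indep: "\<forall>p\<in>B. d p = 0" if d: "(\<Sum>(j, g)\<in>B. d (j, g) *\<^sub>R (g - b j)) = 0" for d
    proof -
      define d0 where "d0 j g = (if (j, g) \<in> B then d (j, g) else 0)" for j g
      \<comment> \<open>Putting minus the total coefficient on b_j turns a relation among the
        differences g - b_j into one among the generators whose coefficients sum to zero over each
        \<open>G j\<close>; minimality of the support excludes exactly these.\<close>
      define d' where "d' j g = d0 j g - (if j \<in> J \<and> g = b j then \<Sum>h\<in>G j. d0 j h else 0)" for j g
      have sum': "(\<Sum>g\<in>G j. d' j g *\<^sub>R f g) = (\<Sum>g\<in>G j. d0 j g *\<^sub>R (f g - f (b j)))"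
        if j: "j \<in> J" for j and f :: "real^'x \<Rightarrow> 'z::real_vector"
      proof -
        have "(\<Sum>g\<in>G j. d' j g *\<^sub>R f g) = (\<Sum>g\<in>G j. d0 j g *\<^sub>R f g) -
            (\<Sum>g\<in>G j. if g = b j then (\<Sum>h\<in>G j. d0 j h) *\<^sub>R f (b j) else 0)"
          unfolding sum_subtractf[symmetric] using j
          by (intro sum.cong) (auto simp: d'_def scaleR_diff_left)
        also have "(\<Sum>g\<in>G j. if g = b j then (\<Sum>h\<in>G j. d0 j h) *\<^sub>R f (b j) else 0) =
            (\<Sum>h\<in>G j. d0 j h *\<^sub>R f (b j))"
          using b(1)[OF j] G(1)[OF j] by (simp add: scaleR_sum_left)
        finally show ?thesis by (simp add: scaleR_diff_right sum_subtractf)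
      qed
      have "d' = (\<lambda>_ _. 0)"
      proof (rule c(2))
        fix j g assume n: "(j, g) \<notin> supp J G c"
        then have "(j, g) \<notin> A" by (simp add: A_def)
        then have 0: "d0 j g = 0" by (simp add: d0_def B)
        have "(\<Sum>h\<in>G j. d0 j h) = 0" if "j \<in> J" "g = b j"
        proof (rule sum.neutral, rule ballI)
          fix h assume "h \<in> G j"
          \<comment> \<open>\<open>b j\<close> lies in \<open>A\<close> whenever n_j > 0, so here
            n_j = 0 and \<open>A\<close> has no pair over \<open>j\<close>.\<close>
          have "\<not> 0 < n j" using b(3) that \<open>(j, g) \<notin> A\<close> by blast
          then show "d0 j h = 0" using AJ(3)[of j h] by (auto simp: d0_def B)
        qed
        then show "d' j g = 0" by (auto simp: d'_def 0)
      next
        show "(\<Sum>g\<in>G j. d' j g) = 0" if "j \<in> J" for j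
          using sum'[OF that, of "\<lambda>_. 1 :: real"] by simp
      next
        have "(\<Sum>j\<in>J. \<Sum>g\<in>G j. d' j g *\<^sub>R g) = (\<Sum>j\<in>J. \<Sum>g\<in>G j. d0 j g *\<^sub>R (g - b j))"
          by (intro sum.cong refl sum')
        also have "\<dots> = (\<Sum>(j, g)\<in>Sigma J G. d0 j g *\<^sub>R (g - b j))"
          using J G by (intro sum.Sigma) auto
        also have "\<dots> = (\<Sum>(j, g)\<in>B. d0 j g *\<^sub>R (g - b j))"
          using J G AJ by (intro sum.mono_neutral_right) (auto simp: B d0_def)
        also have "\<dots> = (\<Sum>(j, g)\<in>B. d (j, g) *\<^sub>R (g - b j))"
          by (intro sum.cong) (auto simp: d0_def)
        finally show "(\<Sum>j\<in>J. \<Sum>g\<in>G j. d' j g *\<^sub>R g) = 0" using d by simp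
      qed
      then have z: "d' j g = 0" for j g by simp
      show ?thesis
      proof
        fix p assume p: "p \<in> B"
        obtain j g where [simp]: "p = (j, g)" by (cases p)
        have "g \<noteq> b j" using p B by simp
        then show "d p = 0" using z[of j g] p by (simp add: d'_def d0_def)
      qed
    qed
    show thesis
    proof (rule face[OF w(1) b(1,2) _ _ card indep])
      show "B \<subseteq> Sigma J G" using AJ by (auto simp: B_def)
      show "w \<bullet> g = w \<bullet> b j" if "(j, g) \<in> B" for j g
        using that weighting_optimal_supp[of J G, OF J G c(1) w(2), of j g "b j"] b(1)[of j] b(2)[of j g] AJ[of j g]
        unfolding B A_def by force
    qed
  qed
qed

section \<open>Exponents as real vectors\<close>

definition emb :: "('x::finite \<Rightarrow>\<^sub>0 nat) \<Rightarrow> real^'x" where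
  "emb u = (\<chi> i. real (Poly_Mapping.lookup u i))"

lemma emb_nth [simp]: "emb u $ i = real (Poly_Mapping.lookup u i)" by (simp add: emb_def)

lemma emb_0 [simp]: "emb 0 = 0" by (simp add: vec_eq_iff)

lemma emb_add: "emb (u + v) = emb u + emb v" by (simp add: vec_eq_iff lookup_add)

lemma emb_sum: "emb (sum f A) = (\<Sum>i\<in>A. emb (f i))"
  by (induction A rule: infinite_finite_induct) (simp_all add: emb_add)

lemma emb_nonneg: "0 \<le> emb u" by (simp add: less_eq_vec_def)

lemma inj_emb: "inj emb"
  by (auto simp: inj_def vec_eq_iff intro!: poly_mapping_eqI)

lemma emb_le_imp_plus:
  assumes "emb u \<le> emb v" obtains t where "v = u + t"
proof
  show "v = u + (v - u)"
    using assms by (intro poly_mapping_eqI) (simp add: less_eq_vec_def lookup_add lookup_minus)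
qed

section \<open>Dickson's lemma\<close>

lemma nat_seq_nondecreasing_subseq:
  fixes s :: "nat \<Rightarrow> nat"
  shows "\<exists>\<phi> :: nat \<Rightarrow> nat. strict_mono \<phi> \<and> (\<forall>m n. m \<le> n \<longrightarrow> s (\<phi> m) \<le> s (\<phi> n))"
proof -
  obtain \<phi> where \<phi>: "strict_mono \<phi>" "monoseq (\<lambda>n. s (\<phi> n))" using seq_monosub by blast
  show ?thesis
  proof (cases "\<forall>m n. m \<le> n \<longrightarrow> s (\<phi> m) \<le> s (\<phi> n)")
    case True then show ?thesis using \<phi>(1) by (intro exI[of _ \<phi>] conjI)
  next
    case False
    then have dec: "\<And>m n. m \<le> n \<Longrightarrow> s (\<phi> n) \<le> s (\<phi> m)"
      using \<phi>(2) unfolding monoseq_def by metis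
    \<comment> \<open>A nonincreasing sequence of naturals is constant from the index where it
      attains its minimum.\<close>
    define N where "N = arg_min (\<lambda>n. s (\<phi> n)) (\<lambda>_. True)"
    have N: "s (\<phi> N) \<le> s (\<phi> n)" for n
      unfolding N_def by (rule arg_min_nat_le) simp
    have "s (\<phi> (n + N)) = s (\<phi> N)" for n using N[of "n + N"] dec[of N "n + N"] by simp
    moreover have "strict_mono (\<lambda>n. \<phi> (n + N))" using \<phi>(1) by (simp add: strict_mono_def)
    ultimately show ?thesis by (intro exI[of _ "\<lambda>n. \<phi> (n + N)"]) simp
  qed
qed

lemma common_nondecreasing_subseq:
  fixes s :: "nat \<Rightarrow> 'x \<Rightarrow> nat"
  assumes "finite A"
  shows "\<exists>\<phi> :: nat \<Rightarrow> nat. strict_mono \<phi> \<and> (\<forall>i\<in>A. \<forall>m n. m \<le> n \<longrightarrow> s (\<phi> m) i \<le> s (\<phi> n) i)"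
  using assms
proof (induction A rule: finite_induct)
  case empty show ?case by (intro exI[of _ "\<lambda>n. n"]) (simp add: strict_mono_def)
next
  case (insert a A)
  then obtain \<phi> :: "nat \<Rightarrow> nat" where \<phi>: "strict_mono \<phi>" "\<forall>i\<in>A. \<forall>m n. m \<le> n \<longrightarrow> s (\<phi> m) i \<le> s (\<phi> n) i"
    by blast
  obtain \<psi> :: "nat \<Rightarrow> nat" where \<psi>: "strict_mono \<psi>" "\<forall>m n. m \<le> n \<longrightarrow> s (\<phi> (\<psi> m)) a \<le> s (\<phi> (\<psi> n)) a"
    using nat_seq_nondecreasing_subseq[of "\<lambda>n. s (\<phi> n) a"] by blast
  have "\<forall>i\<in>A. \<forall>m n. m \<le> n \<longrightarrow> s (\<phi> (\<psi> m)) i \<le> s (\<phi> (\<psi> n)) i"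
    using \<phi>(2) strict_mono_less_eq[OF \<psi>(1)] by simp
  moreover have "strict_mono (\<lambda>n. \<phi> (\<psi> n))" using \<phi>(1) \<psi>(1) by (simp add: strict_mono_def)
  ultimately show ?case using \<psi>(2) by (intro exI[of _ "\<lambda>n. \<phi> (\<psi> n)"]) simp
qed

text \<open>\<open>\<Gamma>\<close> collects the minimal exponents. Infinitely many of them would
  include a sequence of distinct ones with a subsequence nondecreasing in every coordinate, hence
  two distinct comparable ones.\<close>

lemma dickson:
  fixes E :: "('x::finite \<Rightarrow>\<^sub>0 nat) set"
  obtains \<Gamma> where "finite \<Gamma>" "\<Gamma> \<subseteq> E" "E \<subseteq> \<Gamma> + UNIV"
proof -
  define \<Gamma> where "\<Gamma> = {u \<in> E. \<forall>v\<in>E. emb v \<le> emb u \<longrightarrow> v = u}"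
  have "finite \<Gamma>"
  proof (rule ccontr)
    assume "infinite \<Gamma>"
    then obtain s :: "nat \<Rightarrow> ('x \<Rightarrow>\<^sub>0 nat)" where s: "inj s" "range s \<subseteq> \<Gamma>"
      using infinite_countable_subset by blast
    obtain \<phi> :: "nat \<Rightarrow> nat" where \<phi>: "strict_mono \<phi>"
        "\<forall>i\<in>UNIV. \<forall>m n. m \<le> n \<longrightarrow> Poly_Mapping.lookup (s (\<phi> m)) i \<le> Poly_Mapping.lookup (s (\<phi> n)) i"
      using common_nondecreasing_subseq[of UNIV "\<lambda>n. Poly_Mapping.lookup (s n)", OF finite] by blast
    have "emb (s (\<phi> 0)) \<le> emb (s (\<phi> 1))"
      using \<phi>(2) by (simp add: less_eq_vec_def)
    moreover have "s (\<phi> 0) \<in> E" "s (\<phi> 1) \<in> \<Gamma>" using s(2) by (auto simp: \<Gamma>_def)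
    ultimately have "s (\<phi> 0) = s (\<phi> 1)" unfolding \<Gamma>_def by blast
    then have "\<phi> 0 = \<phi> 1" using s(1) by (simp add: inj_eq)
    then show False using strict_monoD[OF \<phi>(1), of 0 1] by simp
  qed
  moreover have "\<exists>g\<in>\<Gamma>. emb g \<le> emb u" if "u \<in> E" for u
  proof -
    define deg where "deg v = (\<Sum>i\<in>UNIV. Poly_Mapping.lookup v i)" for v :: "'x \<Rightarrow>\<^sub>0 nat"
    let ?P = "\<lambda>v. v \<in> E \<and> emb v \<le> emb u"
    \<comment> \<open>Among the members of \<open>E\<close> below \<open>u\<close>, one of least
      total degree has nothing else of \<open>E\<close> below it.\<close>
    define g where "g = arg_min deg ?P"
    have g: "?P g" unfolding g_def using that by (intro arg_min_natI[of ?P u]) simp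
    have min: "deg g \<le> deg v" if "?P v" for v unfolding g_def using that by (rule arg_min_nat_le)
    have "v = g" if v: "v \<in> E" "emb v \<le> emb g" for v
    proof (rule ccontr)
      assume "v \<noteq> g"
      then obtain i where "Poly_Mapping.lookup v i \<noteq> Poly_Mapping.lookup g i"
        by (auto intro: poly_mapping_eqI)
      with v have "deg v < deg g"
        unfolding deg_def by (intro sum_strict_mono_ex1) (auto simp: less_eq_vec_def order.strict_iff_order)
      moreover have "?P v" using v g by (auto intro: order.trans)
      ultimately show False using min[of v] by simp
    qed
    then show ?thesis using g unfolding \<Gamma>_def by blast
  qed
  then have "E \<subseteq> \<Gamma> + UNIV" by (metis emb_le_imp_plus set_plus_intro subsetI UNIV_I)
  moreover have "\<Gamma> \<subseteq> E" by (auto simp: \<Gamma>_def)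
  ultimately show thesis using that by blast
qed

section \<open>Weights of power products\<close>

lemma npow_weight:
  fixes w :: "real^'x::finite"
  assumes "\<And>e. e \<in> E \<Longrightarrow> m \<le> w \<bullet> emb e" "\<And>i. 0 \<le> w $ i" "u \<in> npow E n"
  shows "real n * m \<le> w \<bullet> emb u"
  using assms(3)
proof (induction n arbitrary: u)
  case 0
  have "0 \<le> w \<bullet> emb u" using assms(2) by (simp add: inner_vec_def sum_nonneg)
  then show ?case by simp
next
  case (Suc n)
  then obtain a b where "u = a + b" "a \<in> npow E n" "b \<in> E" by (auto simp: npow_Suc elim: set_plus_elim)
  then show ?case using Suc.IH[of a] assms(1)[of b] by (simp add: emb_add inner_add_right algebra_simps)
qed

lemma ppow_weight:
  fixes w :: "real^'x::finite"
  assumes "finite J" "\<And>j e. j \<in> J \<Longrightarrow> e \<in> E j \<Longrightarrow> m j \<le> w \<bullet> emb e" "\<And>i. 0 \<le> w $ i"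
    and "u \<in> ppow J E n"
  shows "(\<Sum>j\<in>J. real (n j) * m j) \<le> w \<bullet> emb u"
  using assms(1,2,4)
proof (induction J arbitrary: u rule: finite_induct)
  case empty
  have "0 \<le> w \<bullet> emb u" using assms(3) by (simp add: inner_vec_def sum_nonneg)
  then show ?case by simp
next
  case (insert j J)
  then obtain a b where ab: "u = a + b" "a \<in> npow (E j) (n j)" "b \<in> ppow J E n"
    by (auto simp: ppow_insert elim: set_plus_elim)
  have "real (n j) * m j \<le> w \<bullet> emb a"
    using insert.prems(1) assms(3) ab(2) by (intro npow_weight[of "E j"]) auto
  moreover have "(\<Sum>j\<in>J. real (n j) * m j) \<le> w \<bullet> emb b"
    using insert.prems(1) ab(3) by (intro insert.IH) auto
  ultimately show ?case using insert.hyps by (simp add: ab(1) emb_add inner_add_right)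
qed

lemma npow_combination:
  assumes "finite \<Gamma>" "\<Gamma> \<subseteq> E"
  shows "(\<Sum>g\<in>\<Gamma>. \<Sum>i<c g. g) \<in> npow E (\<Sum>g\<in>\<Gamma>. c g :: nat)"
  using assms
proof (induction \<Gamma> rule: finite_induct)
  case (insert g \<Gamma>)
  have "(\<Sum>i<k. g) \<in> npow E k" for k
    using insert.prems by (induction k) (auto simp: npow_Suc intro: set_plus_intro)
  then show ?case using insert by (simp add: npow_add set_plus_intro)
qed simp

lemma ppow_combination:
  assumes "finite J" "\<And>j. j \<in> J \<Longrightarrow> y j \<in> npow (E j) (n j)"
  shows "(\<Sum>j\<in>J. y j) \<in> ppow J E n"
  using assms by (induction J rule: finite_induct) (auto simp: ppow_insert intro: set_plus_intro)

section \<open>Valuations and integral dependence\<close>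

text \<open>The bound is an \<open>m\<close>-fold sum because \<open>h\<close> has values in an
  ordered monoid without scalars; it is applied both to real weights and to the refined
  order.\<close>

lemma keys_power:
  fixes f :: "('a::comm_monoid_add) \<Rightarrow>\<^sub>0 'k::comm_semiring_1"
    and h :: "'a \<Rightarrow> 'b::ordered_comm_monoid_add"
  assumes "\<And>a b. h (a + b) = h a + h b" "h 0 = 0" "\<And>u. u \<in> Poly_Mapping.keys f \<Longrightarrow> l \<le> h u"
    and "v \<in> Poly_Mapping.keys (f ^ m)"
  shows "(\<Sum>i<m. l) \<le> h v"
  using assms(4)
proof (induction m arbitrary: v)
  case (Suc m)
  then obtain a b where "v = a + b" "a \<in> Poly_Mapping.keys f" "b \<in> Poly_Mapping.keys (f ^ m)"
    using Poly_Mapping.keys_mult[of f "f ^ m"] by auto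
  then show ?case using Suc.IH[of b] assms(1,3) by (simp add: add_mono add.commute)
qed (simp add: assms(2) split: if_splits)

text \<open>As \<open>h\<close> is injective, all other exponents of \<open>f\<close> and
  \<open>g\<close> are strictly above \<open>a\<close> and \<open>b\<close>, so no other pair of
  terms contributes at \<open>a + b\<close>.\<close>

lemma lookup_mult_least:
  fixes f g :: "('a::comm_monoid_add) \<Rightarrow>\<^sub>0 'k::comm_ring_1"
    and h :: "'a \<Rightarrow> 'b::linordered_ab_group_add"
  assumes h: "\<And>a b. h (a + b) = h a + h b" "inj h"
    and f: "\<And>u. u \<in> Poly_Mapping.keys f \<Longrightarrow> h a \<le> h u"
    and g: "\<And>u. u \<in> Poly_Mapping.keys g \<Longrightarrow> h b \<le> h u"
  shows "Poly_Mapping.lookup (f * g) (a + b) = Poly_Mapping.lookup f a * Poly_Mapping.lookup g b"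
proof -
  define f' where "f' = f - Poly_Mapping.single a (Poly_Mapping.lookup f a)"
  define g' where "g' = g - Poly_Mapping.single b (Poly_Mapping.lookup g b)"
  have f': "h a < h u" if "u \<in> Poly_Mapping.keys f'" for u
  proof -
    have "u \<noteq> a" "u \<in> Poly_Mapping.keys f"
      using that by (auto simp: f'_def in_keys_iff lookup_minus lookup_single when_def split: if_splits)
    then show ?thesis using f[of u] h(2) by (metis injD order_le_less)
  qed
  have g': "h b < h u" if "u \<in> Poly_Mapping.keys g'" for u
  proof -
    have "u \<noteq> b" "u \<in> Poly_Mapping.keys g"
      using that by (auto simp: g'_def in_keys_iff lookup_minus lookup_single when_def split: if_splits)
    then show ?thesis using g[of u] h(2) by (metis injD order_le_less)
  qed
  have "a + b \<notin> Poly_Mapping.keys (f' * g)"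
  proof
    assume "a + b \<in> Poly_Mapping.keys (f' * g)"
    then obtain u v where "a + b = u + v" "u \<in> Poly_Mapping.keys f'" "v \<in> Poly_Mapping.keys g"
      using Poly_Mapping.keys_mult[of f' g] by auto
    then have "h a + h b = h u + h v" "h a < h u" "h b \<le> h v" using f' g h(1) by metis+
    then show False using add_less_le_mono[of "h a" "h u" "h b" "h v"] by simp
  qed
  moreover have "a + b \<notin> Poly_Mapping.keys (Poly_Mapping.single a (Poly_Mapping.lookup f a) * g')"
  proof
    assume "a + b \<in> Poly_Mapping.keys (Poly_Mapping.single a (Poly_Mapping.lookup f a) * g')"
    then obtain v where "a + b = a + v" "v \<in> Poly_Mapping.keys g'"
      using Poly_Mapping.keys_mult[of "Poly_Mapping.single a (Poly_Mapping.lookup f a)" g']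
      by (auto split: if_splits)
    then have "h a + h b = h a + h v" "h b < h v" using g' h(1) by metis+
    then show False by simp
  qed
  moreover have "f * g = Poly_Mapping.single (a + b) (Poly_Mapping.lookup f a * Poly_Mapping.lookup g b) +
      Poly_Mapping.single a (Poly_Mapping.lookup f a) * g' + f' * g"
    by (simp add: f'_def g'_def algebra_simps mult_single)
  ultimately show ?thesis by (simp add: lookup_add in_keys_iff)
qed

lemma lookup_power_least:
  fixes f :: "('a::comm_monoid_add) \<Rightarrow>\<^sub>0 'k::comm_ring_1"
    and h :: "'a \<Rightarrow> 'b::linordered_ab_group_add"
  assumes h: "\<And>a b. h (a + b) = h a + h b" "inj h"
    and f: "\<And>u. u \<in> Poly_Mapping.keys f \<Longrightarrow> h a \<le> h u"
  shows "Poly_Mapping.lookup (f ^ m) (\<Sum>i<m. a) = Poly_Mapping.lookup f a ^ m"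
proof (induction m)
  case (Suc m)
  have h0: "h 0 = 0" using h(1)[of 0 0] by simp
  have hs: "h (\<Sum>i<m. a) = (\<Sum>i<m. h a)" by (induction m) (simp_all add: h0 h(1))
  have "Poly_Mapping.lookup (f * f ^ m) (a + (\<Sum>i<m. a)) =
      Poly_Mapping.lookup f a * Poly_Mapping.lookup (f ^ m) (\<Sum>i<m. a)"
    using h f keys_power[of h f "h a", OF h(1) h0 f] by (intro lookup_mult_least[of h]) (auto simp: hs)
  then show ?case by (simp add: Suc add.commute)
qed simp

text \<open>Refining the weight lexicographically by the coordinates makes the order total, so that the
  least term of a power cannot cancel.\<close>

lemma weight_order_embedding:
  fixes w :: "real^'x::finite"
  obtains h :: "('x \<Rightarrow>\<^sub>0 nat) \<Rightarrow> (nat \<Rightarrow>\<^sub>0 real)" where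
    "\<And>a b. h (a + b) = h a + h b" "inj h" "\<And>a b. h a \<le> h b \<Longrightarrow> w \<bullet> emb a \<le> w \<bullet> emb b"
proof -
  obtain idx :: "'x \<Rightarrow> nat" where idx: "inj idx"
    using finite_imp_inj_to_nat_seg[of "UNIV :: 'x set"] by auto
  \<comment> \<open>Coordinate 0 carries the weight and is compared first; the others record the
    exponent and give injectivity.\<close>
  define h where "h u = Poly_Mapping.single 0 (w \<bullet> emb u) +
      (\<Sum>x\<in>UNIV. Poly_Mapping.single (Suc (idx x)) (real (Poly_Mapping.lookup u x)))" for u :: "'x \<Rightarrow>\<^sub>0 nat"
  have l0: "Poly_Mapping.lookup (h u) 0 = w \<bullet> emb u" for u
    by (simp add: h_def lookup_add lookup_sum lookup_single)
  have ls: "Poly_Mapping.lookup (h u) (Suc (idx x)) = real (Poly_Mapping.lookup u x)" for u x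
    by (simp add: h_def lookup_add lookup_sum lookup_single when_def inj_eq[OF idx])
  show thesis
  proof
    show "h (a + b) = h a + h b" for a b
      by (simp add: h_def emb_add inner_add_right single_add lookup_add sum.distrib algebra_simps)
    show "inj h"
    proof (rule injI, rule poly_mapping_eqI)
      fix u v x assume "h u = h v"
      then show "Poly_Mapping.lookup u x = Poly_Mapping.lookup v x" using ls[of u x] ls[of v x] by simp
    qed
    fix a b assume "h a \<le> h b"
    then consider "h a = h b" | "h a < h b" by fastforce
    then have "Poly_Mapping.lookup (h a) 0 \<le> Poly_Mapping.lookup (h b) 0"
    proof cases
      case 2
      then obtain k where "Poly_Mapping.lookup (h a) k < Poly_Mapping.lookup (h b) k"
          "\<And>k'. k' < k \<Longrightarrow> Poly_Mapping.lookup (h a) k' = Poly_Mapping.lookup (h b) k'"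
        by (auto simp: less_poly_mapping.rep_eq less_fun_def)
      then show ?thesis by (cases "k = 0") auto
    qed simp
    then show "w \<bullet> emb a \<le> w \<bullet> emb b" by (simp add: l0)
  qed
qed

text \<open>Let \<open>u0\<close> be the least exponent of \<open>f\<close>. The term of f^m at m u0
  does not vanish, so some a_i f^(m-i) has a term there, of weight at least i \<open>\<mu>\<close> +
  (m - i) w(u0). If w(u0) < \<open>\<mu>\<close>, this exceeds m w(u0).\<close>

lemma integral_weight_ge:
  fixes f :: "('x::finite, 'k::field) mpoly" and w :: "real^'x"
  assumes eq: "f ^ m + (\<Sum>i\<in>{1..m}. a i * f ^ (m - i)) = 0"
    and a: "\<And>i e. i \<in> {1..m} \<Longrightarrow> e \<in> Poly_Mapping.keys (a i) \<Longrightarrow> real i * \<mu> \<le> w \<bullet> emb e"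
    and u: "u \<in> Poly_Mapping.keys f"
  shows "\<mu> \<le> w \<bullet> emb u"
proof -
  obtain h :: "('x \<Rightarrow>\<^sub>0 nat) \<Rightarrow> (nat \<Rightarrow>\<^sub>0 real)" where h:
    "\<And>a b. h (a + b) = h a + h b" "inj h" "\<And>a b. h a \<le> h b \<Longrightarrow> w \<bullet> emb a \<le> w \<bullet> emb b"
    using weight_order_embedding[of w] by blast
  have "Poly_Mapping.keys f \<noteq> {}" using u by blast
  then obtain u0 where u0: "u0 \<in> Poly_Mapping.keys f" "\<And>v. v \<in> Poly_Mapping.keys f \<Longrightarrow> h u0 \<le> h v"
    using ex_is_arg_min_if_finite[of "Poly_Mapping.keys f" h] unfolding is_arg_min_linorder by auto
  have "\<mu> \<le> w \<bullet> emb u0"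
  proof (rule ccontr)
    assume "\<not> \<mu> \<le> w \<bullet> emb u0"
    then have lt: "w \<bullet> emb u0 < \<mu>" by simp
    let ?p = "\<Sum>i<m. u0"
    have "Poly_Mapping.lookup (f ^ m) ?p \<noteq> 0"
      using u0(1) lookup_power_least[of h f u0 m, OF h(1,2) u0(2)] by (simp add: in_keys_iff)
    moreover have "Poly_Mapping.lookup (f ^ m + (\<Sum>i\<in>{1..m}. a i * f ^ (m - i))) ?p = 0"
      by (simp only: eq lookup_zero)
    ultimately have "(\<Sum>i\<in>{1..m}. Poly_Mapping.lookup (a i * f ^ (m - i)) ?p) \<noteq> 0"
      by (auto simp: lookup_add lookup_sum)
    then obtain i where i: "i \<in> {1..m}" "Poly_Mapping.lookup (a i * f ^ (m - i)) ?p \<noteq> 0"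
      by (rule sum.not_neutral_contains_not_neutral)
    then have "?p \<in> Poly_Mapping.keys (a i * f ^ (m - i))" by (simp add: in_keys_iff)
    then obtain e v where ev: "?p = e + v" "e \<in> Poly_Mapping.keys (a i)" "v \<in> Poly_Mapping.keys (f ^ (m - i))"
      using Poly_Mapping.keys_mult[of "a i" "f ^ (m - i)"] by blast
    have "(\<Sum>j<m - i. w \<bullet> emb u0) \<le> w \<bullet> emb v"
      by (rule keys_power[OF _ _ _ ev(3)]) (auto simp: emb_add inner_add_right intro: h(3) u0(2))
    moreover have "w \<bullet> emb ?p = real m * (w \<bullet> emb u0)" by (simp only: emb_sum inner_sum_right) simp
    then have "real m * (w \<bullet> emb u0) = w \<bullet> emb e + w \<bullet> emb v"
      by (simp add: ev(1) emb_add inner_add_right)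
    moreover have "real i * (w \<bullet> emb u0) < real i * \<mu>" using lt i(1) by simp
    ultimately show False using a[OF i(1) ev(2)] i(1) by (simp add: of_nat_diff algebra_simps)
  qed
  also have "\<dots> \<le> w \<bullet> emb u" using u0(2)[OF u] by (rule h(3))
  finally show ?thesis .
qed

section \<open>Integral closure of power products of monomial ideals\<close>

text \<open>\<open>\<Gamma>\<close> makes finite generating sets available, hence polytopes;
  \<open>K\<close> carries the coefficient field, which the exponent sets do not mention.\<close>

locale monomial_family =
  fixes J :: "'j set" and E \<Gamma> :: "'j \<Rightarrow> ('x::finite \<Rightarrow>\<^sub>0 nat) set" and K :: "'k::field itself"
  assumes finite_J: "finite J"
    and upset_E: "j \<in> J \<Longrightarrow> upset (E j)"
    and finite_\<Gamma>: "j \<in> J \<Longrightarrow> finite (\<Gamma> j)"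
    and nonempty_\<Gamma>: "j \<in> J \<Longrightarrow> \<Gamma> j \<noteq> {}"
    and \<Gamma>_sub: "j \<in> J \<Longrightarrow> \<Gamma> j \<subseteq> E j"
    and E_sub: "j \<in> J \<Longrightarrow> E j \<subseteq> \<Gamma> j + UNIV"
begin

abbreviation "G j \<equiv> emb ` \<Gamma> j"

lemma finite_G: "j \<in> J \<Longrightarrow> finite (G j)" by (simp add: finite_\<Gamma>)
lemma nonempty_G: "j \<in> J \<Longrightarrow> G j \<noteq> {}" by (simp add: nonempty_\<Gamma>)

definition newton :: "('j \<Rightarrow> nat) \<Rightarrow> (real^'x) set" where
  "newton n = {x. \<exists>d\<in>polysum J G n. d \<le> x}"

lemma sum_G: "(\<Sum>g\<in>G j. f g) = (\<Sum>\<gamma>\<in>\<Gamma> j. f (emb \<gamma>))"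
  by (rule sum.reindex_cong[of emb]) (auto intro: inj_on_subset[OF inj_emb])

lemma newton_iff: "x \<in> newton n \<longleftrightarrow> (\<exists>d c. weighting J G n d c \<and> d \<le> x)"
  unfolding newton_def using polysum_iff[of J G, OF finite_J finite_G nonempty_G] by blast

lemma newton_eq_plus: "newton n = {x + y | x y. x \<in> polysum J G n \<and> y \<in> {0..}}"
proof (intro subset_antisym subsetI)
  fix x assume "x \<in> newton n"
  then obtain d where "d \<in> polysum J G n" "d \<le> x" by (auto simp: newton_def)
  then show "x \<in> {x + y | x y. x \<in> polysum J G n \<and> y \<in> {0..}}"
    by (intro CollectI exI[of _ d] exI[of _ "x - d"]) auto
next
  fix z assume "z \<in> {x + y | x y. x \<in> polysum J G n \<and> y \<in> {0..}}"
  then obtain x y where "z = x + y" "x \<in> polysum J G n" "0 \<le> y" by auto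
  then show "z \<in> newton n" unfolding newton_def by (intro CollectI bexI[of _ x]) auto
qed

lemma closed_newton: "closed (newton n)"
proof -
  have "compact (polysum J G n)"
    by (intro polytope_imp_compact polytope_polysum finite_J finite_G)
  then have "closed (\<Union>x\<in>polysum J G n. \<Union>y\<in>{0..}. {x + y})"
    by (rule compact_closed_sums) (rule closed_eucl_atLeast)
  also have "(\<Union>x\<in>polysum J G n. \<Union>y\<in>{0..}. {x + y}) = newton n"
    unfolding newton_eq_plus by blast
  finally show ?thesis .
qed

lemma convex_newton: "convex (newton n)"
proof -
  have "convex (polysum J G n)"
    by (intro polytope_imp_convex polytope_polysum finite_J finite_G)
  moreover have "convex {0 :: real^'x..}"
    unfolding convex_alt by (auto intro!: add_nonneg_nonneg scaleR_nonneg_nonneg)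
  ultimately have "convex (polysum J G n + {0..})" by (rule convex_set_plus)
  also have "polysum J G n + {0..} = newton n"
    unfolding newton_eq_plus set_plus_def by blast
  finally show ?thesis .
qed

lemma vertex_in_newton:
  assumes "\<And>j. j \<in> J \<Longrightarrow> y j \<in> \<Gamma> j"
  shows "(\<Sum>j\<in>J. real (n j) *\<^sub>R emb (y j)) \<in> polysum J G n"
proof -
  have "\<forall>j\<in>J. real (n j) *\<^sub>R emb (y j) \<in> (\<lambda>z. real (n j) *\<^sub>R z) ` (convex hull (G j))"
    using assms by (auto intro!: imageI hull_inc)
  then show ?thesis unfolding polysum_def set_sum_alt[OF finite_J]
    by (intro CollectI exI[of _ "\<lambda>j. real (n j) *\<^sub>R emb (y j)"]) simp
qed

text \<open>The polyhedron is closed, convex and stable under adding nonnegative vectors, so a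
  separating functional has nonnegative coordinates. For \<open>m j\<close> its minimum over the
  generators \<open>\<Gamma> j\<close> is taken.\<close>

lemma newton_separation:
  assumes "x \<notin> newton n"
  obtains a :: "real^'x" and m where "\<And>i. 0 \<le> a $ i" "\<And>j e. j \<in> J \<Longrightarrow> e \<in> E j \<Longrightarrow> m j \<le> a \<bullet> emb e"
    "a \<bullet> x < (\<Sum>j\<in>J. real (n j) * m j)"
proof -
  obtain a b where ab: "a \<bullet> x < b" "\<And>z. z \<in> newton n \<Longrightarrow> b < a \<bullet> z"
    using separating_hyperplane_closed_point[OF convex_newton closed_newton assms] by blast
  have "\<exists>\<gamma>\<in>\<Gamma> j. \<forall>\<gamma>'\<in>\<Gamma> j. a \<bullet> emb \<gamma> \<le> a \<bullet> emb \<gamma>'" if "j \<in> J" for j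
    using ex_is_arg_min_if_finite[OF finite_\<Gamma>[OF that] nonempty_\<Gamma>[OF that], of "\<lambda>\<gamma>. a \<bullet> emb \<gamma>"]
    unfolding is_arg_min_linorder by blast
  then obtain y where y: "\<And>j. j \<in> J \<Longrightarrow> y j \<in> \<Gamma> j"
      "\<And>j \<gamma>. j \<in> J \<Longrightarrow> \<gamma> \<in> \<Gamma> j \<Longrightarrow> a \<bullet> emb (y j) \<le> a \<bullet> emb \<gamma>"
    by metis
  let ?p = "\<Sum>j\<in>J. real (n j) *\<^sub>R emb (y j)"
  have p: "?p \<in> polysum J G n" by (intro vertex_in_newton y(1))
  have a: "0 \<le> a $ i" for i
  proof (rule ccontr)
    assume "\<not> 0 \<le> a $ i"
    then have neg: "a $ i < 0" by simp
    \<comment> \<open>Moving \<open>?p\<close> by \<open>t\<close> along axis \<open>i\<close> stays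
      in the polyhedron but brings the value of the functional down to \<open>b\<close> or
      below.\<close>
    define t where "t = max 0 ((b - a \<bullet> ?p) / a $ i)"
    have "0 \<le> t *\<^sub>R axis i (1::real)"
      unfolding t_def by (intro scaleR_nonneg_nonneg) (auto simp: less_eq_vec_def axis_def)
    then have "?p + t *\<^sub>R axis i 1 \<in> newton n"
      using p unfolding newton_eq_plus by (intro CollectI exI[of _ ?p] exI[of _ "t *\<^sub>R axis i 1"]) simp
    then have "b < a \<bullet> (?p + t *\<^sub>R axis i 1)" by (rule ab(2))
    then have "b < a \<bullet> ?p + t * a $ i"
      by (simp only: inner_add_right inner_scaleR_right inner_axis) simp
    moreover have "(b - a \<bullet> ?p) / a $ i \<le> t" by (simp add: t_def)
    then have "t * a $ i \<le> b - a \<bullet> ?p" using neg by (simp only: neg_divide_le_eq)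
    ultimately show False by simp
  qed
  have ge: "a \<bullet> emb (y j) \<le> a \<bullet> emb e" if je: "j \<in> J" "e \<in> E j" for j e
  proof -
    have "e \<in> \<Gamma> j + UNIV" using E_sub[OF je(1)] je(2) by (rule subsetD)
    then obtain \<gamma> v where "e = \<gamma> + v" "\<gamma> \<in> \<Gamma> j" by (rule set_plus_elim)
    moreover have "0 \<le> a \<bullet> emb v" using a by (simp add: inner_vec_def sum_nonneg)
    ultimately show ?thesis using y(2)[OF je(1), of \<gamma>] by (simp add: emb_add inner_add_right)
  qed
  have "?p \<in> newton n" using p by (auto simp: newton_def)
  then have "b < (\<Sum>j\<in>J. real (n j) * (a \<bullet> emb (y j)))"
    using ab(2)[of ?p] by (simp add: inner_sum_right)
  with ab(1) have "a \<bullet> x < (\<Sum>j\<in>J. real (n j) * (a \<bullet> emb (y j)))" by simp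
  then show thesis using a ge by (rule that[rotated 2])
qed

text \<open>Integral closedness in terms of exponents. With both implications at hand, the induction
  on |n| runs on exponents alone.\<close>

definition newton_closed :: "('j \<Rightarrow> nat) \<Rightarrow> bool" where
  "newton_closed n \<longleftrightarrow> (\<forall>u. emb u \<in> newton n \<longrightarrow> u \<in> ppow J E n)"

text \<open>If an exponent of \<open>f\<close> lay outside the polyhedron, a separating weight would
  be at least i times the bound on the i-th power of the ideal, and the integral equation would
  force the exponent up to that bound.\<close>

lemma integrally_closed_if_newton_closed:
  assumes "newton_closed n"
  shows "integrally_closed_ideal mpoly_ring (mspan (ppow J E n) :: ('x, 'k) mpoly set)"
  unfolding integrally_closed_ideal_def
proof
  let ?I = "mspan (ppow J E n) :: ('x, 'k) mpoly set"
  show "ideal ?I mpoly_ring" by (simp add: mspan_ideal)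
  show "ideal_integral_closure mpoly_ring ?I = ?I"
  proof
    show "?I \<subseteq> ideal_integral_closure mpoly_ring ?I"
    proof
      fix f assume "f \<in> ?I"
      \<comment> \<open>The equation of degree one, f + (-f) = 0.\<close>
      then show "f \<in> ideal_integral_closure mpoly_ring ?I"
        unfolding ideal_integral_closure_def
        by (auto simp: ideal_pow_mspan type_ring_finsum mspan_uminus intro!: exI[of _ 1] exI[of _ "\<lambda>_. - f"])
    qed
    show "ideal_integral_closure mpoly_ring ?I \<subseteq> ?I"
    proof
      fix f assume "f \<in> ideal_integral_closure mpoly_ring ?I"
      then obtain m and a :: "nat \<Rightarrow> ('x, 'k) mpoly" where
        a: "\<forall>i\<in>{1..m}. a i \<in> mspan (npow (ppow J E n) i)" and
        eq: "f ^ m + (\<Sum>i\<in>{1..m}. a i * f ^ (m - i)) = 0"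
        unfolding ideal_integral_closure_def by (auto simp: ideal_pow_mspan type_ring_finsum)
      have "u \<in> ppow J E n" if u: "u \<in> Poly_Mapping.keys f" for u
      proof (rule ccontr)
        assume "u \<notin> ppow J E n"
        then have "emb u \<notin> newton n" using assms by (auto simp: newton_closed_def)
        then obtain w :: "real^'x" and \<mu> where w: "\<And>i. 0 \<le> w $ i"
            "\<And>j e. j \<in> J \<Longrightarrow> e \<in> E j \<Longrightarrow> \<mu> j \<le> w \<bullet> emb e"
            "w \<bullet> emb u < (\<Sum>j\<in>J. real (n j) * \<mu> j)"
          by (rule newton_separation) blast
        have "(\<Sum>j\<in>J. real (n j) * \<mu> j) \<le> w \<bullet> emb e" if "e \<in> ppow J E n" for e
          using that w by (intro ppow_weight[OF finite_J, of E]) auto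
        then have "real i * (\<Sum>j\<in>J. real (n j) * \<mu> j) \<le> w \<bullet> emb e" if "e \<in> npow (ppow J E n) i" for e i
          using that w(1) by (intro npow_weight[of "ppow J E n"]) auto
        moreover have "e \<in> npow (ppow J E n) i" if "i \<in> {1..m}" "e \<in> Poly_Mapping.keys (a i)" for i e
          using bspec[OF a that(1)] that(2) by (auto simp: mspan_def)
        ultimately have "(\<Sum>j\<in>J. real (n j) * \<mu> j) \<le> w \<bullet> emb u"
          by (intro integral_weight_ge[OF eq _ u]) blast
        with w(3) show False by simp
      qed
      then show "f \<in> ?I" by (auto simp: mspan_def)
    qed
  qed
qed

text \<open>Dirichlet's simultaneous approximation theorem makes the real weights integral.\<close>

lemma newton_multiple:
  assumes "emb u \<in> newton n"
  obtains q :: nat where "0 < q" "(\<Sum>i<q. u) \<in> npow (ppow J E n) q"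
proof -
  obtain d c0 where "weighting J G n d c0" "d \<le> emb u" using assms newton_iff by blast
  define c where "c j \<gamma> = c0 j (emb \<gamma>)" for j \<gamma>
  have c: "\<And>j \<gamma>. j \<in> J \<Longrightarrow> \<gamma> \<in> \<Gamma> j \<Longrightarrow> 0 \<le> c j \<gamma>" "\<And>j. j \<in> J \<Longrightarrow> (\<Sum>\<gamma>\<in>\<Gamma> j. c j \<gamma>) = real (n j)"
      "(\<Sum>j\<in>J. \<Sum>\<gamma>\<in>\<Gamma> j. c j \<gamma> *\<^sub>R emb \<gamma>) \<le> emb u"
    using \<open>weighting J G n d c0\<close> \<open>d \<le> emb u\<close> by (auto simp: weighting_def sum_G c_def)
  define S where "S = Sigma J \<Gamma>"
  have finS: "finite S" unfolding S_def using finite_J finite_\<Gamma> by blast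
  obtain f where f: "bij_betw f {..<card S} S"
    using ex_bij_betw_nat_finite[OF finS] by (auto simp: atLeast0LessThan)
  \<comment> \<open>\<open>N\<close> exceeds the number of generators over each index and, in every
    coordinate, the total of all generators. Rounding errors below 1/N then add up to less than 1 in
    both counts, and integrality removes them.\<close>
  define N where "N = Suc (\<Sum>(j, \<gamma>)\<in>S. 1 + (\<Sum>i\<in>UNIV. Poly_Mapping.lookup \<gamma> i))"
  have "0 < N" by (simp add: N_def)
  obtain q p where qp: "0 < q" "\<And>i. i < card S \<Longrightarrow> \<bar>of_int q * case_prod c (f i) - of_int (p i)\<bar> < 1 / N"
    using Dirichlet_approx_simult[OF \<open>0 < N\<close>, of "card S" "\<lambda>i. case_prod c (f i)"] by metis
  define a where "a s = nat (p (inv_into {..<card S} f s))" for s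
  have a: "\<bar>real_of_int q * c j \<gamma> - real (a (j, \<gamma>))\<bar> < 1 / N" if "(j, \<gamma>) \<in> S" for j \<gamma>
  proof -
    let ?i = "inv_into {..<card S} f (j, \<gamma>)"
    have i: "?i < card S" "f ?i = (j, \<gamma>)"
      using bij_betw_inv_into_right[OF f that] bij_betw_apply[OF bij_betw_inv_into[OF f] that] by auto
    have "0 \<le> real_of_int q * c j \<gamma>" using that qp(1) c(1) by (simp add: S_def)
    moreover have *: "\<bar>real_of_int q * c j \<gamma> - of_int (p ?i)\<bar> < 1 / N" using qp(2)[OF i(1)] by (simp add: i(2))
    moreover have "1 / real N \<le> 1" using \<open>0 < N\<close> by (simp add: divide_le_eq_1)
    \<comment> \<open>Dirichlet's integers may be negative; lying within 1 of a nonnegative real,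
      these are not, so \<open>nat\<close> loses nothing.\<close>
    ultimately have "-1 < real_of_int (p ?i)" by linarith
    then have "0 \<le> p ?i" by linarith
    then show ?thesis using * by (simp add: a_def)
  qed
  let ?q = "nat q"
  have q: "real_of_int q = real ?q" using qp(1) by simp
  have sum_a: "(\<Sum>\<gamma>\<in>\<Gamma> j. a (j, \<gamma>)) = ?q * n j" if j: "j \<in> J" for j
  proof -
    have "card (\<Gamma> j) = (\<Sum>s\<in>{j} \<times> \<Gamma> j. 1)" by (simp add: card_cartesian_product_singleton)
    also have "\<dots> \<le> (\<Sum>s\<in>{j} \<times> \<Gamma> j. case s of (j, \<gamma>) \<Rightarrow> 1 + (\<Sum>i\<in>UNIV. Poly_Mapping.lookup \<gamma> i))"
      by (intro sum_mono) auto
    also have "\<dots> \<le> (\<Sum>(j, \<gamma>)\<in>S. 1 + (\<Sum>i\<in>UNIV. Poly_Mapping.lookup \<gamma> i))"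
      using finS j by (intro sum_mono2) (auto simp: S_def)
    finally have "card (\<Gamma> j) < N" by (simp add: N_def)
    have "\<bar>real (?q * n j) - real (\<Sum>\<gamma>\<in>\<Gamma> j. a (j, \<gamma>))\<bar> = \<bar>\<Sum>\<gamma>\<in>\<Gamma> j. real_of_int q * c j \<gamma> - real (a (j, \<gamma>))\<bar>"
      using c(2)[OF j] by (simp add: sum_subtractf q flip: sum_distrib_left)
    also have "\<dots> \<le> (\<Sum>\<gamma>\<in>\<Gamma> j. \<bar>real_of_int q * c j \<gamma> - real (a (j, \<gamma>))\<bar>)" by (rule sum_abs)
    also have "\<dots> \<le> (\<Sum>\<gamma>\<in>\<Gamma> j. 1 / real N)" using a j by (intro sum_mono less_imp_le) (auto simp: S_def)
    also have "\<dots> < 1" using \<open>card (\<Gamma> j) < N\<close> by simp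
    \<comment> \<open>Two integers at distance less than 1 are equal.\<close>
    finally show ?thesis by linarith
  qed
  define v where "v = (\<Sum>j\<in>J. \<Sum>\<gamma>\<in>\<Gamma> j. \<Sum>i<a (j, \<gamma>). \<gamma>)"
  have "v \<in> ppow J E (\<lambda>j. ?q * n j)"
    unfolding v_def
  proof (intro ppow_combination finite_J)
    fix j assume "j \<in> J"
    then show "(\<Sum>\<gamma>\<in>\<Gamma> j. \<Sum>i<a (j, \<gamma>). \<gamma>) \<in> npow (E j) (?q * n j)"
      using npow_combination[OF finite_\<Gamma> \<Gamma>_sub, of j "\<lambda>\<gamma>. a (j, \<gamma>)"] sum_a by simp
  qed
  then have v: "v \<in> npow (ppow J E n) ?q" by (simp add: npow_ppow finite_J)
  have "Poly_Mapping.lookup v i \<le> Poly_Mapping.lookup (\<Sum>k<?q. u) i" for i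
  proof -
    have "real (Poly_Mapping.lookup v i) = (\<Sum>j\<in>J. \<Sum>\<gamma>\<in>\<Gamma> j. real (a (j, \<gamma>)) * real (Poly_Mapping.lookup \<gamma> i))"
      unfolding v_def lookup_sum by (simp add: lookup_sum)
    also have "\<dots> = (\<Sum>(j, \<gamma>)\<in>S. real (a (j, \<gamma>)) * real (Poly_Mapping.lookup \<gamma> i))"
      unfolding S_def using finite_J finite_\<Gamma> by (intro sum.Sigma) auto
    also have "\<dots> \<le> (\<Sum>(j, \<gamma>)\<in>S. real ?q * (c j \<gamma> * real (Poly_Mapping.lookup \<gamma> i)) +
        (1 / N) * real (Poly_Mapping.lookup \<gamma> i))"
    proof (rule sum_mono, clarify)
      fix j \<gamma> assume "(j, \<gamma>) \<in> S"
      then have "real (a (j, \<gamma>)) \<le> real ?q * c j \<gamma> + 1 / N" using a[of j \<gamma>] unfolding q by linarith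
      then have "real (a (j, \<gamma>)) * real (Poly_Mapping.lookup \<gamma> i) \<le>
          (real ?q * c j \<gamma> + 1 / N) * real (Poly_Mapping.lookup \<gamma> i)"
        by (rule mult_right_mono) simp
      then show "real (a (j, \<gamma>)) * real (Poly_Mapping.lookup \<gamma> i) \<le>
          real ?q * (c j \<gamma> * real (Poly_Mapping.lookup \<gamma> i)) + (1 / N) * real (Poly_Mapping.lookup \<gamma> i)"
        by (simp only: distrib_right mult.assoc)
    qed
    also have "\<dots> = real ?q * (\<Sum>(j, \<gamma>)\<in>S. c j \<gamma> * real (Poly_Mapping.lookup \<gamma> i)) +
        (1 / N) * (\<Sum>(j, \<gamma>)\<in>S. real (Poly_Mapping.lookup \<gamma> i))"
      by (simp only: case_prod_unfold sum.distrib sum_distrib_left)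
    also have "(\<Sum>(j, \<gamma>)\<in>S. c j \<gamma> * real (Poly_Mapping.lookup \<gamma> i)) =
        (\<Sum>j\<in>J. \<Sum>\<gamma>\<in>\<Gamma> j. c j \<gamma> * real (Poly_Mapping.lookup \<gamma> i))"
      unfolding S_def using finite_J finite_\<Gamma> by (intro sum.Sigma[symmetric]) auto
    also have "\<dots> \<le> real (Poly_Mapping.lookup u i)"
      using c(3) by (simp add: less_eq_vec_def)
    finally have le: "real (Poly_Mapping.lookup v i) \<le> real ?q * real (Poly_Mapping.lookup u i) +
        (1 / N) * (\<Sum>(j, \<gamma>)\<in>S. real (Poly_Mapping.lookup \<gamma> i))"
      by (simp add: mult_left_mono)
    have "(\<Sum>(j, \<gamma>)\<in>S. Poly_Mapping.lookup \<gamma> i) \<le> (\<Sum>(j, \<gamma>)\<in>S. 1 + (\<Sum>i\<in>UNIV. Poly_Mapping.lookup \<gamma> i))"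
      by (intro sum_mono) (auto intro!: le_SucI member_le_sum)
    then have "(\<Sum>(j, \<gamma>)\<in>S. Poly_Mapping.lookup \<gamma> i) < N" by (simp add: N_def)
    then have "real (\<Sum>(j, \<gamma>)\<in>S. Poly_Mapping.lookup \<gamma> i) < real N" by (simp only: of_nat_less_iff)
    then have "(1 / N) * (\<Sum>(j, \<gamma>)\<in>S. real (Poly_Mapping.lookup \<gamma> i)) < 1"
      using \<open>0 < N\<close> by (simp add: case_prod_unfold)
    with le have "real (Poly_Mapping.lookup v i) < real ?q * real (Poly_Mapping.lookup u i) + 1" by linarith
    then have "real (Poly_Mapping.lookup v i) < real (?q * Poly_Mapping.lookup u i + 1)" by simp
    then have "Poly_Mapping.lookup v i < ?q * Poly_Mapping.lookup u i + 1" by (simp only: of_nat_less_iff)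
    then show ?thesis by (simp add: lookup_sum)
  qed
  then have "emb v \<le> emb (\<Sum>k<?q. u)" by (simp add: less_eq_vec_def)
  then obtain t where "(\<Sum>k<?q. u) = v + t" by (rule emb_le_imp_plus)
  with v have "(\<Sum>k<?q. u) \<in> npow (ppow J E n) ?q" using upset_npow[of "ppow J E n" ?q] by (auto simp: upset_def)
  with qp(1) that[of ?q] show thesis by simp
qed

text \<open>For a suitable q, X^(qu) lies in the q-th power of the ideal, so X^u is a root of the
  equation x^q - X^(qu) = 0.\<close>

lemma newton_closed_if_integrally_closed:
  assumes "integrally_closed_ideal mpoly_ring (mspan (ppow J E n) :: ('x, 'k) mpoly set)"
  shows "newton_closed n"
  unfolding newton_closed_def
proof (intro allI impI)
  fix u :: "'x \<Rightarrow>\<^sub>0 nat" assume "emb u \<in> newton n"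
  then obtain q where q: "0 < q" "(\<Sum>i<q. u) \<in> npow (ppow J E n) q" by (rule newton_multiple)
  let ?I = "mspan (ppow J E n) :: ('x, 'k) mpoly set"
  let ?x = "monomial u :: ('x, 'k) mpoly"
  define a where "a i = (if i = q then - (?x ^ q) else 0)" for i
  have "?x ^ k = monomial (\<Sum>i<k. u)" for k
    by (induction k) (simp_all add: monomial_def mult_single add.commute)
  then have a: "a i \<in> ideal_pow mpoly_ring ?I i" for i
    using q by (auto simp: a_def ideal_pow_mspan zero_in_mspan intro: mspan_uminus)
  have "(\<Sum>i\<in>{1..q}. a i * ?x ^ (q - i)) = (\<Sum>i\<in>{1..q}. if i = q then - (?x ^ q) else 0)"
    by (intro sum.cong) (auto simp: a_def)
  also have "\<dots> = - (?x ^ q)" using q(1) by simp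
  finally have "?x ^ q + (\<Sum>i\<in>{1..q}. a i * ?x ^ (q - i)) = 0" by simp
  then have "?x \<in> ideal_integral_closure mpoly_ring ?I"
    unfolding ideal_integral_closure_def using q(1) a
    by (intro CollectI conjI exI[of _ q] exI[of _ a]) (simp_all add: type_ring_finsum)
  then have "?x \<in> ?I" using assms by (simp add: integrally_closed_ideal_def)
  then show "u \<in> ppow J E n" by simp
qed

end

section \<open>Faces of the product ideal and the induction on |n|\<close>

lemma dual_functionals:
  fixes x :: "'b \<Rightarrow> 'a::euclidean_space"
  assumes "finite B" and indep: "\<And>d. (\<Sum>p\<in>B. d p *\<^sub>R x p) = 0 \<Longrightarrow> \<forall>p\<in>B. d p = 0"
  obtains L :: "'b \<Rightarrow> 'a \<Rightarrow> real" where "\<And>p. p \<in> B \<Longrightarrow> linear (L p)"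
    "\<And>p q. p \<in> B \<Longrightarrow> q \<in> B \<Longrightarrow> L p (x q) = (if q = p then 1 else 0)"
proof -
  \<comment> \<open>The family is indexed, so repetitions are excluded first: one would give the
    relation x p - x q = 0.\<close>
  have inj: "inj_on x B"
  proof (rule inj_onI, rule ccontr)
    fix p q assume pq: "p \<in> B" "q \<in> B" "x p = x q" "p \<noteq> q"
    let ?d = "\<lambda>r. (if r = p then 1 else 0) - (if r = q then 1 else 0 :: real)"
    have "(\<Sum>r\<in>B. ?d r *\<^sub>R x r) =
        (\<Sum>r\<in>B. (if r = p then x p else 0) - (if r = q then x q else 0))"
      by (intro sum.cong) auto
    also have "\<dots> = 0" using assms(1) pq by (simp add: sum_subtractf)
    finally have "?d p = 0" using indep[of ?d] pq(1) by blast
    then show False using pq(4) by simp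
  qed
  have "independent (x ` B)"
  proof
    assume "dependent (x ` B)"
    then obtain c where c: "\<exists>v\<in>x ` B. c v \<noteq> 0" "(\<Sum>v\<in>x ` B. c v *\<^sub>R v) = 0"
      using dependent_finite[of "x ` B"] assms(1) by auto
    have "(\<Sum>p\<in>B. c (x p) *\<^sub>R x p) = 0"
      using c(2) by (simp add: sum.reindex[OF inj])
    then show False using indep[of "\<lambda>p. c (x p)"] c(1) by blast
  qed
  then have "\<exists>g :: 'a \<Rightarrow> real. linear g \<and> (\<forall>v\<in>x ` B. g v = (if v = x p then 1 else 0))" for p
    by (rule linear_independent_extend)
  then obtain L :: "'b \<Rightarrow> 'a \<Rightarrow> real" where
    L: "\<And>p. linear (L p)" "\<And>p v. v \<in> x ` B \<Longrightarrow> L p v = (if v = x p then 1 else 0)"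
    by metis
  show thesis
  proof (rule that[of L])
    show "L p (x q) = (if q = p then 1 else 0)" if "p \<in> B" "q \<in> B" for p q
      using L(2)[of "x q" p] that inj_onD[OF inj, of q p] by auto
  qed (rule L(1))
qed

context monomial_family
begin

lemma sum_in_product:
  assumes "\<And>j. j \<in> J \<Longrightarrow> y j \<in> E j"
  shows "(\<Sum>j\<in>J. y j) \<in> ppow J E (\<lambda>_. 1)"
proof (intro ppow_combination finite_J)
  fix j assume "j \<in> J"
  then show "y j \<in> npow (E j) 1" using assms[of j] npow_1[OF upset_E, of j] by simp
qed

text \<open>\<open>e0\<close> and the exchanged sums \<open>e1 p\<close> lie on the
  \<open>w\<close>-minimal face of the product ideal and are affinely independent. Their barycentric
  coordinates, homogenised by the degree, are the functionals fed to
  \<open>exponent_face\<close>.\<close>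

lemma analytic_spread_face:
  fixes w :: "real^'x"
  assumes w: "\<And>i. 0 < w $ i"
    and \<beta>: "\<And>j. j \<in> J \<Longrightarrow> \<beta> j \<in> \<Gamma> j"
      "\<And>j \<gamma>. j \<in> J \<Longrightarrow> \<gamma> \<in> \<Gamma> j \<Longrightarrow> w \<bullet> emb (\<beta> j) \<le> w \<bullet> emb \<gamma>"
    and B: "B \<subseteq> Sigma J \<Gamma>" "\<And>j \<gamma>. (j, \<gamma>) \<in> B \<Longrightarrow> w \<bullet> emb \<gamma> = w \<bullet> emb (\<beta> j)"
    and indep: "\<And>d. (\<Sum>p\<in>B. d p *\<^sub>R (emb (snd p) - emb (\<beta> (fst p)))) = 0 \<Longrightarrow> \<forall>p\<in>B. d p = 0"
  shows "enat (Suc (card B)) \<le> analytic_spread (mspan (ppow J E (\<lambda>_. 1)) :: ('x, 'k) mpoly set)"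
proof -
  let ?E = "ppow J E (\<lambda>_. 1)"
  define x where "x p = emb (snd p) - emb (\<beta> (fst p))" for p :: "'j \<times> ('x \<Rightarrow>\<^sub>0 nat)"
  have finB: "finite B" using B(1) finite_J finite_\<Gamma> by (meson finite_SigmaI finite_subset)
  obtain L where L: "\<And>p. p \<in> B \<Longrightarrow> linear (L p)"
      "\<And>p q. p \<in> B \<Longrightarrow> q \<in> B \<Longrightarrow> L p (x q) = (if q = p then 1 else 0 :: real)"
    using dual_functionals[OF finB, of x] indep unfolding x_def by blast
  obtain f where f: "bij_betw f {..<card B} B"
    using ex_bij_betw_nat_finite[OF finB] by (auto simp: atLeast0LessThan)
  have fB: "f l \<in> B" if "l < card B" for l using bij_betw_apply[OF f] that by simp
  have f_eq: "f l = f m \<longleftrightarrow> l = m" if "l < card B" "m < card B" for l m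
    using f that by (auto simp: bij_betw_def inj_on_def)
  define e0 where "e0 = (\<Sum>j\<in>J. \<beta> j)"
  define e1 where "e1 p = (\<Sum>j\<in>J. if j = fst p then snd p else \<beta> j)" for p :: "'j \<times> ('x \<Rightarrow>\<^sub>0 nat)"
  define \<mu> where "\<mu> = (\<Sum>j\<in>J. w \<bullet> emb (\<beta> j))"
  have e1: "emb (e1 p) = emb e0 + x p" if "p \<in> B" for p
  proof -
    have p: "fst p \<in> J" using B(1) that by auto
    have "emb (e1 p) - emb e0 = (\<Sum>j\<in>J. if j = fst p then x p else 0)"
      unfolding e1_def e0_def emb_sum sum_subtractf[symmetric]
      by (intro sum.cong) (auto simp: x_def)
    also have "\<dots> = x p" using p finite_J by simp
    finally show ?thesis by (simp add: algebra_simps)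
  qed
  have wx: "w \<bullet> x p = 0" if "p \<in> B" for p
    using B(2)[of "fst p" "snd p"] that by (simp add: x_def inner_diff_right)
  have we0: "w \<bullet> emb e0 = \<mu>" by (simp add: e0_def \<mu>_def emb_sum inner_sum_right)
  define e where "e i = (case i of 0 \<Rightarrow> e0 | Suc l \<Rightarrow> e1 (f l))" for i
  define lf where "lf l u n = L (f l) (emb u - real n *\<^sub>R emb e0)" for l u n
  \<comment> \<open>Coordinate 0 is the degree minus the other coordinates, so it is 1 at
    \<open>e0\<close> and 0 at each \<open>e1 p\<close>: the one dimension beyond
    \<open>card B\<close>. Later indices get 0 to keep additivity valid for all of them.\<close>
  define h where "h i u n = (case i of 0 \<Rightarrow> real n - (\<Sum>l<card B. lf l u n) | Suc l \<Rightarrow> if l < card B then lf l u n else 0)"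
    for i u n
  have add: "lf l (u + v) (a + b) = lf l u a + lf l v b" if "l < card B" for l u v a b
  proof -
    have "emb (u + v) - real (a + b) *\<^sub>R emb e0 =
        (emb u - real a *\<^sub>R emb e0) + (emb v - real b *\<^sub>R emb e0)"
      by (simp add: emb_add algebra_simps)
    then show ?thesis unfolding lf_def by (simp only: linear_add[OF L(1)[OF fB[OF that]]])
  qed
  have lf0: "lf l e0 1 = 0" if "l < card B" for l
    using linear_0[OF L(1)[OF fB[OF that]]] by (simp add: lf_def)
  have lf1: "lf l (e1 (f m)) 1 = (if m = l then 1 else 0)" if "l < card B" "m < card B" for l m
    using L(2)[OF fB fB, OF that] f_eq[of m l] that by (simp add: lf_def e1[OF fB])
  interpret exponent_face ?E "\<lambda>u n. w \<bullet> emb u - real n * \<mu>" h e "Suc (card B)" K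
  proof
    fix u v :: "'x \<Rightarrow>\<^sub>0 nat" and a b n l i :: nat and y :: 'x
    show "upset ?E" by simp
    show "w \<bullet> emb (u + v) - real (a + b) * \<mu> = w \<bullet> emb u - real a * \<mu> + (w \<bullet> emb v - real b * \<mu>)"
      by (simp add: emb_add inner_add_right algebra_simps)
    show "0 \<le> w \<bullet> emb u - real n * \<mu>" if "u \<in> npow ?E n"
    proof -
      have E: "w \<bullet> emb (\<beta> j) \<le> w \<bullet> emb c" if "j \<in> J" "c \<in> E j" for j c
      proof -
        have "c \<in> \<Gamma> j + UNIV" using E_sub[OF \<open>j \<in> J\<close>] \<open>c \<in> E j\<close> by (rule subsetD)
        then obtain \<gamma> t where c: "c = \<gamma> + t" "\<gamma> \<in> \<Gamma> j" by (rule set_plus_elim)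
        have "0 \<le> w \<bullet> emb t" using w by (simp add: inner_vec_def sum_nonneg less_imp_le)
        then show ?thesis using \<beta>(2)[OF \<open>j \<in> J\<close> c(2)] by (simp add: c(1) emb_add inner_add_right)
      qed
      have "u \<in> ppow J E (\<lambda>j. n * 1)" using that by (simp only: npow_ppow[OF finite_J])
      then have "(\<Sum>j\<in>J. real (n * 1) * (w \<bullet> emb (\<beta> j))) \<le> w \<bullet> emb u"
        using E w by (intro ppow_weight[OF finite_J]) (auto intro: less_imp_le)
      then show ?thesis by (simp add: \<mu>_def sum_distrib_left)
    qed
    have "emb (Poly_Mapping.single y 1) = axis y (1::real)"
      by (simp add: vec_eq_iff axis_def lookup_single when_def)
    then show "0 < w \<bullet> emb (Poly_Mapping.single y 1) - real 0 * \<mu>"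
      using w[of y] by (simp add: inner_axis)
    show "h l (u + v) (a + b) = h l u a + h l v b"
      by (cases l) (simp_all add: h_def add sum.distrib)
    assume i: "i < Suc (card B)"
    have e1in: "e1 p \<in> ?E" if "p \<in> B" for p
      unfolding e1_def using B(1) that \<beta>(1) \<Gamma>_sub by (intro sum_in_product) force
    have e0in: "e0 \<in> ?E" unfolding e0_def using \<beta>(1) \<Gamma>_sub by (intro sum_in_product) blast
    show "e i \<in> ?E" using i fB e1in e0in by (cases i) (simp_all add: e_def)
    show "w \<bullet> emb (e i) - real 1 * \<mu> = 0"
      using i fB wx e1 by (cases i) (simp_all add: e_def we0 inner_add_right)
    assume l: "l < Suc (card B)"
    show "h l (e i) 1 = (if l = i then 1 else 0)"
    proof (cases i)
      case 0
      then show ?thesis using l lf0 by (cases l) (simp_all add: h_def e_def)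
    next
      case (Suc m)
      then have m: "m < card B" using i by simp
      have "(\<Sum>l<card B. lf l (e1 (f m)) 1) = (\<Sum>l<card B. if l = m then 1 else 0)"
        using lf1 m by (intro sum.cong) auto
      also have "\<dots> = 1" using m by simp
      finally show ?thesis using l m Suc lf1 by (cases l) (auto simp: h_def e_def)
    qed
  qed
  show ?thesis by (rule analytic_spread_ge)
qed

text \<open>\<open>big\<close> rules out the large face, so some weight is at least 1; lowering it
  by 1 leaves a weighting with n_j lowered by 1.\<close>

lemma newton_step:
  assumes u: "emb u \<in> newton n"
    and big: "\<not> enat (\<Sum>j\<in>J. n j) + 1 \<le> analytic_spread (mspan (ppow J E (\<lambda>_. 1)) :: ('x, 'k) mpoly set)"
  obtains j \<gamma> u' where "j \<in> J" "\<gamma> \<in> \<Gamma> j" "0 < n j" "u = u' + \<gamma>" "emb u' \<in> newton (n(j := n j - 1))"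
proof -
  obtain d where d: "d \<in> polysum J G n" "d \<le> emb u" using u by (auto simp: newton_def)
  show thesis
  proof (cases rule: large_weight_or_large_face
      [of J G d n "emb u", case_names fin_J fin_G nonempty_G member le weight face])
    case (weight v c j g)
    then obtain \<gamma> where \<gamma>: "\<gamma> \<in> \<Gamma> j" "g = emb \<gamma>" by blast
    have c: "\<And>i g. i \<in> J \<Longrightarrow> g \<in> G i \<Longrightarrow> 0 \<le> c i g" "\<And>i. i \<in> J \<Longrightarrow> (\<Sum>g\<in>G i. c i g) = real (n i)"
        "(\<Sum>i\<in>J. \<Sum>g\<in>G i. c i g *\<^sub>R g) = v"
      using weight(1) by (auto simp: weighting_def)
    have "c j g \<le> real (n j)"
      using member_le_sum[of g "G j" "c j"] c(1,2) weight(3,4) finite_G by auto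
    then have nj: "0 < n j" using weight(5) by linarith
    define c' where "c' = c(j := (c j)(g := c j g - 1))"
    have sm: "(\<Sum>h\<in>G j. c' j h *\<^sub>R k h) = (\<Sum>h\<in>G j. c j h *\<^sub>R k h) - k g"
      for k :: "real^'x \<Rightarrow> 'z::real_vector"
    proof -
      have "(\<Sum>h\<in>G j. c j h *\<^sub>R k h) - (\<Sum>h\<in>G j. c' j h *\<^sub>R k h) = (\<Sum>h\<in>G j. if h = g then k g else 0)"
        unfolding sum_subtractf[symmetric] by (intro sum.cong) (auto simp: c'_def algebra_simps)
      also have "\<dots> = k g" using finite_G[OF weight(3)] weight(4) by simp
      finally show ?thesis by (simp add: algebra_simps)
    qed
    have weighting': "weighting J G (n(j := n j - 1)) (v - g) c'"
      unfolding weighting_def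
    proof (intro conjI ballI)
      fix i h assume "i \<in> J" "h \<in> G i"
      then show "0 \<le> c' i h" using c(1) weight(5) by (auto simp: c'_def)
    next
      fix i assume "i \<in> J"
      then show "(\<Sum>h\<in>G i. c' i h) = real ((n(j := n j - 1)) i)"
        using sm[of "\<lambda>_. 1 :: real"] c(2) nj by (cases "i = j") (auto simp: c'_def of_nat_diff)
    next
      have "(\<Sum>i\<in>J. \<Sum>h\<in>G i. c' i h *\<^sub>R h) = (\<Sum>h\<in>G j. c' j h *\<^sub>R h) + (\<Sum>i\<in>J - {j}. \<Sum>h\<in>G i. c' i h *\<^sub>R h)"
        by (rule sum.remove[OF finite_J weight(3)])
      also have "(\<Sum>i\<in>J - {j}. \<Sum>h\<in>G i. c' i h *\<^sub>R h) = (\<Sum>i\<in>J - {j}. \<Sum>h\<in>G i. c i h *\<^sub>R h)"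
        by (intro sum.cong refl) (auto simp: c'_def)
      finally show "(\<Sum>i\<in>J. \<Sum>h\<in>G i. c' i h *\<^sub>R h) = v - g"
        using c(3) sum.remove[OF finite_J weight(3), of "\<lambda>i. \<Sum>h\<in>G i. c i h *\<^sub>R h"]
        by (simp add: sm[of "\<lambda>h. h"])
    qed
    \<comment> \<open>v - g is a nonnegative combination of exponent vectors, so g <= v <= u and
      \<open>\<gamma>\<close> can be subtracted from \<open>u\<close> without truncation.\<close>
    have nonneg: "0 \<le> (\<Sum>i\<in>J. \<Sum>h\<in>G i. c' i h *\<^sub>R h)"
      using weighting' emb_nonneg by (intro sum_nonneg scaleR_nonneg_nonneg) (auto simp: weighting_def)
    then have "g \<le> v" using weighting' by (simp add: weighting_def)
    then have "emb \<gamma> \<le> emb u" using weight(2) \<gamma>(2) by (metis order.trans)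
    then obtain u' where u': "u = \<gamma> + u'" by (rule emb_le_imp_plus)
    have "v - g \<le> emb u'" using weight(2) by (simp add: u' \<gamma>(2) emb_add algebra_simps)
    then have "emb u' \<in> newton (n(j := n j - 1))" using weighting' newton_iff by blast
    then show thesis using that[of j \<gamma> u'] weight(3) \<gamma>(1) nj u' by (simp add: add.commute)
  next
    case (face w b B)
    \<comment> \<open>Faces arrive as real vectors; \<open>e\<close> returns to exponents,
      faithfully because every vector in question is an embedded generator.\<close>
    define e where "e = inv_into UNIV (emb :: ('x \<Rightarrow>\<^sub>0 nat) \<Rightarrow> real^'x)"
    have ie: "e (emb \<gamma>) = \<gamma>" for \<gamma> unfolding e_def by (rule inv_f_f[OF inj_emb])
    have ei: "emb (e g) = g" if "j \<in> J" "g \<in> G j" for j g using that by (auto simp: ie)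
    define B' where "B' = (\<lambda>(j, g). (j, e g)) ` B"
    have BJ: "fst p \<in> J" "snd p \<in> G (fst p)" if "p \<in> B" for p using face(4) that by auto
    have inj: "inj_on (\<lambda>(j, g). (j, e g)) B"
    proof (rule inj_onI)
      fix p q assume "p \<in> B" "q \<in> B" "(\<lambda>(j, g). (j, e g)) p = (\<lambda>(j, g). (j, e g)) q"
      then have "fst p = fst q" "e (snd p) = e (snd q)" by (simp_all add: case_prod_unfold)
      moreover have "snd p = emb (e (snd p))" "snd q = emb (e (snd q))"
        using ei[OF BJ[OF \<open>p \<in> B\<close>]] ei[OF BJ[OF \<open>q \<in> B\<close>]] by simp_all
      ultimately show "p = q" by (metis prod_eqI)
    qed
    have emb_b: "emb (e (b j)) = b j" if "j \<in> J" for j using ei[OF that face(2)[OF that]] .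
    have "enat (Suc (card B')) \<le> analytic_spread (mspan (ppow J E (\<lambda>_. 1)) :: ('x, 'k) mpoly set)"
    proof (rule analytic_spread_face[of w "\<lambda>j. e (b j)"])
      show "0 < w $ i" for i by (rule face(1))
      show "e (b j) \<in> \<Gamma> j" if "j \<in> J" for j using face(2)[OF that] by (auto simp: ie)
      show "w \<bullet> emb (e (b j)) \<le> w \<bullet> emb \<gamma>" if "j \<in> J" "\<gamma> \<in> \<Gamma> j" for j \<gamma>
        using face(3)[OF that(1), of "emb \<gamma>"] that by (simp add: emb_b)
      show "B' \<subseteq> Sigma J \<Gamma>" using BJ by (force simp: B'_def ie)
      show "w \<bullet> emb \<gamma> = w \<bullet> emb (e (b j))" if "(j, \<gamma>) \<in> B'" for j \<gamma>
      proof -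
        from that obtain g where g: "(j, g) \<in> B" "\<gamma> = e g" by (auto simp: B'_def)
        then show ?thesis using face(5)[OF g(1)] BJ[OF g(1)] ei[of j g] emb_b[of j] by simp
      qed
      fix d assume "(\<Sum>p\<in>B'. d p *\<^sub>R (emb (snd p) - emb (e (b (fst p))))) = 0"
      also have "(\<Sum>p\<in>B'. d p *\<^sub>R (emb (snd p) - emb (e (b (fst p))))) =
          (\<Sum>(j, g)\<in>B. d (j, e g) *\<^sub>R (g - b j))"
        unfolding B'_def sum.reindex[OF inj]
        using ei[OF BJ] emb_b[OF BJ(1)] by (intro sum.cong) (auto simp: case_prod_unfold)
      finally have "\<forall>p\<in>B. (\<lambda>(j, g). d (j, e g)) p = 0"
        by (intro face(7)) simp
      then show "\<forall>p\<in>B'. d p = 0" by (auto simp: B'_def)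
    qed
    moreover have "card B' = card B" unfolding B'_def by (rule card_image[OF inj])
    ultimately have "enat (\<Sum>j\<in>J. n j) + 1 \<le> analytic_spread (mspan (ppow J E (\<lambda>_. 1)) :: ('x, 'k) mpoly set)"
      using face(6) by (simp add: one_enat_def) (metis Suc_le_mono enat_ord_simps(1) order.trans)
    with big show thesis by contradiction
  qed (use d finite_J finite_G nonempty_G in blast)+
qed

lemma newton_closed_all:
  assumes "\<And>n. enat (\<Sum>j\<in>J. n j) + 1 \<le> analytic_spread (mspan (ppow J E (\<lambda>_. 1)) :: ('x, 'k) mpoly set) \<Longrightarrow>
    newton_closed n"
  shows "newton_closed n"
proof (induction "\<Sum>j\<in>J. n j" arbitrary: n rule: less_induct)
  case less
  show ?case
  proof (cases "enat (\<Sum>j\<in>J. n j) + 1 \<le> analytic_spread (mspan (ppow J E (\<lambda>_. 1)) :: ('x, 'k) mpoly set)")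
    case True then show ?thesis by (rule assms)
  next
    case False
    show ?thesis
      unfolding newton_closed_def
    proof (intro allI impI)
      fix u assume "emb u \<in> newton n"
      then obtain j \<gamma> u' where *: "j \<in> J" "\<gamma> \<in> \<Gamma> j" "0 < n j" "u = u' + \<gamma>"
          "emb u' \<in> newton (n(j := n j - 1))"
        using False by (rule newton_step)
      let ?n = "n(j := n j - 1)"
      have n: "n = ?n(j := Suc (?n j))" using *(3) by auto
      have "(\<Sum>j\<in>J. ?n j) < (\<Sum>j\<in>J. n j)"
        using *(1,3) finite_J by (intro sum_strict_mono_ex1) auto
      then have "newton_closed ?n" by (rule less)
      then have "u' \<in> ppow J E ?n" using *(5) by (simp add: newton_closed_def)
      then have "u \<in> ppow J E ?n + E j" using *(1,2,4) \<Gamma>_sub by (auto intro: set_plus_intro)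
      then show "u \<in> ppow J E n"
        by (subst n) (simp only: ppow_add_index[OF finite_J *(1)])
    qed
  qed
qed

end

text \<open>The bound is written |n| + 1 <= \<lambda>, which avoids the truncated subtraction in
  \<lambda> - 1.\<close>

theorem corollary5p8:
  fixes r :: nat
    and I :: "nat \<Rightarrow> ('x::finite, 'k::field) mpoly set"
  assumes "r \<ge> 1"
    and "\<And>j. j \<in> {1..r} \<Longrightarrow> monomial_ideal (I j)"
    and "\<And>j. j \<in> {1..r} \<Longrightarrow> I j \<noteq> {0}"
    and "\<And>n :: nat \<Rightarrow> nat.
           enat (\<Sum>j=1..r. n j) + 1 \<le> analytic_spread (\<Otimes>\<^bsub>ideals_set mpoly_ring\<^esub> j\<in>{1..r}. I j) \<Longrightarrow>
           integrally_closed_ideal mpoly_ring (power_product mpoly_ring r I n)"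
  shows "\<forall>n :: nat \<Rightarrow> nat. integrally_closed_ideal mpoly_ring (power_product mpoly_ring r I n)"
proof
  fix n :: "nat \<Rightarrow> nat"
  have "\<exists>E. upset E \<and> I j = mspan E" if "j \<in> {1..r}" for j
    using assms(2)[OF that] by (metis monomial_idealE)
  then obtain E where E: "\<And>j. j \<in> {1..r} \<Longrightarrow> upset (E j)" "\<And>j. j \<in> {1..r} \<Longrightarrow> I j = mspan (E j)"
    by metis
  have "\<exists>\<Gamma>. finite \<Gamma> \<and> \<Gamma> \<subseteq> E j \<and> E j \<subseteq> \<Gamma> + UNIV" for j by (metis dickson)
  then obtain \<Gamma> where \<Gamma>: "\<And>j. finite (\<Gamma> j)" "\<And>j. \<Gamma> j \<subseteq> E j" "\<And>j. E j \<subseteq> \<Gamma> j + UNIV" by metis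
  have "\<Gamma> j \<noteq> {}" if j: "j \<in> {1..r}" for j
  proof
    assume "\<Gamma> j = {}"
    \<comment> \<open>With no generators only the zero polynomial remains, against
      \<open>I j\<close> being nonzero.\<close>
    then have "E j = {}" using \<Gamma>(3)[of j] by (simp add: set_plus_def)
    then show False using assms(3)[OF j] by (simp add: E(2)[OF j] mspan_def)
  qed
  note nonempty = this
  interpret monomial_family "{1..r}" E \<Gamma> "TYPE('k)"
    by (rule monomial_family.intro; (erule E(1) | erule nonempty | rule finite_atLeastAtMost \<Gamma>))
  have spread: "(\<Otimes>\<^bsub>ideals_set mpoly_ring\<^esub> j\<in>{1..r}. I j) = mspan (ppow {1..r} E (\<lambda>_. 1))"
    by (intro finprod_mspan E)
  have pp: "power_product mpoly_ring r I n = mspan (ppow {1..r} E n)" for n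
    by (intro power_product_mspan E)
  have "newton_closed n"
  proof (rule newton_closed_all)
    fix n assume "enat (\<Sum>j=1..r. n j) + 1 \<le> analytic_spread (mspan (ppow {1..r} E (\<lambda>_. 1)) :: ('x, 'k) mpoly set)"
    then have "integrally_closed_ideal mpoly_ring (power_product mpoly_ring r I n)"
      by (intro assms(4)) (simp only: spread)
    then show "newton_closed n" unfolding pp by (rule newton_closed_if_integrally_closed)
  qed
  then show "integrally_closed_ideal mpoly_ring (power_product mpoly_ring r I n)"
    unfolding pp by (rule integrally_closed_if_newton_closed)
qed

end
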